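(* Let $\mathcal{G}$ be a graph with Euclidean edges, let $Z_{\mathcal{G}}$ be the associated auxiliary Gaussian random field on $\mathcal{G}$, and let $d_R(u,v)=\mathrm{var}(Z_{\mathcal{G}}(u)-Z_{\mathcal{G}}(v))$ be the resistance metric on $\mathcal{G}$. Let $f$ be a real-valued square-integrable function on $\mathbb{R}$, let $X$ be a stationary Poisson point process in $\mathbb{R}$ with intensity $1$ independent of $Z_{\mathcal{G}}(\cdot)$, and let $\{\epsilon(x):x\in\mathbb{R}\}$ be mutually independent weights with $\mathbb{P}(\epsilon(x)=1)=\mathbb{P}(\epsilon(x)=-1)=1/2$ for each $x\in\mathbb{R}$, independent of $X$ and $Z_{\mathcal{G}}(\cdot)$. Define the random field $$Y(u) := \sum_{x\in X}\epsilon(x)\,f\big(Z_{\mathcal{G}}(u)-x\big),\qquad u\in\mathcal{G}.$$ Then $Y$ has a zero mean and is isotropic with respect to the resistance metric. Its covariance function, denoted $C_Y$, so that $\mathrm{cov}(Y(u),Y(v))=C_Y(d_R(u,v))$ for $u,v\in\mathcal{G}$, is given by $$C_Y(d_R(u,v)) = \frac{1}{\sqrt{2\pi}}\int_{\mathbb{R}}\psi_f\left(\sqrt{d_R(u,v)}\,z\right)\exp(-z^2/2)\,\mathrm{d}z,$$ where $\psi_f(h)=\int_{\mathbb{R}}f(x+h)f(x)\,\mathrm{d}x$, $h\in\mathbb{R}$, is the transitive covariogram of $f$.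
   Context: Graph with Euclidean edges: a triple $\mathcal{G}=(\mathcal{V},\mathcal{E},\{\varphi_e\}_{e\in\mathcal{E}})$ such that: (a) $(\mathcal{V},\mathcal{E})$ is a graph with vertex set $\mathcal{V}$ and edge set $\mathcal{E}$, assumed simple and connected, i.e. $\mathcal{V}$ is finite, there are no repeated edges and no edges joining a vertex to itself, and every pair of vertices is connected by a path; (b) each edge $e\in\mathcal{E}$ is associated with a unique abstract set, also denoted $e$, such that $\mathcal{V}$ and all the edge sets are mutually disjoint; (c) if $e$ joins the vertices $u,v$, then $\varphi_e$ is a bijective mapping defined on $e\cup\{u,v\}$ that maps $e$ onto an open interval $(\underline{e},\overline{e})\subset\mathbb{R}$ and $\{u,v\}$ onto $\{\underline{e},\overline{e}\}$. Writing $u\in\mathcal{G}$ means $u\in\mathcal{V}\cup\bigcup_{e\in\mathcal{E}}e$. For $u\in e$, $\underline{u}$ and $\overline{u}$ denote the vertices joined by $e$ that correspond, respectively, to $\underline{e}$ and $\overline{e}$; for $u\in\mathcal{V}$, $\underline{u}=\overline{u}=u$. Two vertices are neighbors if some edge joins them. Auxiliary field: $Z_{\mathcal{G}}(u)=Z_\mu(u)+\sum_{e\in\mathcal{E}}Z_e(u)$, $u\in\mathcal{G}$, where: (i) on the vertices $v_1,\dots,v_n$ of $\mathcal{G}$, $(Z_\mu(v_1),\dots,Z_\mu(v_n))^\top\sim\mathcal{N}(0,L^{-1})$. Here, for $u,v\in\mathcal{V}$, $c(u,v)=1/d_G(u,v)$ if $u,v$ are neighbors, with $d_G(u,v)$ the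 length of the edge joining them, and $c(u,v)=0$ otherwise; $c(u)=\sum_{v}c(u,v)$; $u_0\in\mathcal{V}$ is an arbitrary vertex; and $L(u,v)=1+c(u_0)$ if $u=v=u_0$, $L(u,v)=c(u)$ if $u=v\neq u_0$, and $L(u,v)=-c(u,v)$ otherwise ($L$ is strictly positive definite); (ii) $Z_\mu$ is extended to the edges by the linear interpolation $Z_\mu(u)=(1-d(u))Z_\mu(\underline{u})+d(u)Z_\mu(\overline{u})$, where $d(u)=d_G(u,\underline{u})/d_G(\underline{u},\overline{u})$ if $u\notin\mathcal{V}$ (for $u\in e$, $d_G(u,\underline{u})$ is the length $|\varphi_e(u)-\underline{e}|$ of the part of the edge between $u$ and $\underline{u}$, and $d_G(\underline{u},\overline{u})=\overline{e}-\underline{e}$) and $d(u)=0$ otherwise; (iii) $Z_e(u)=B_e(\varphi_e(u))$ for $u\in e$ and $Z_e(u)=0$ otherwise, where the $B_e$, $e\in\mathcal{E}$, are independent standard Brownian bridges, independent of $Z_\mu$, with $B_e(\underline{e})=B_e(\overline{e})=0$. Isotropic with respect to $d_R$ means that the covariance between $Y(u)$ and $Y(v)$ depends on $(u,v)$ only through $d_R(u,v)$.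
   Formalization: The weights at the points of X, along a measurable enumeration of X, are also assumed i.i.d. signs independent of the points and of Z; otherwise setting ε=1 on X gives nonzero mean. The sum over X is the limit over windows [-n,n]; f is Borel measurable. *)

theory Defs
  imports "HOL-Probability.Probability"
begin

section \<open>Graphs with Euclidean edges\<close>

text \<open>
  An edge is the unordered pair of the vertices it joins. The abstract set associated with the
  edge e is edge_points G e, and the bijection of e is chart G e. Everything lives in one type.
\<close>

record 'a egraph =
  vertices :: "'a set"
  edges :: "'a set set"
  edge_points :: "'a set \<Rightarrow> 'a set"
  chart :: "'a set \<Rightarrow> 'a \<Rightarrow> real"

definition euclidean_graph :: "'a egraph \<Rightarrow> bool" where
  "euclidean_graph G \<longleftrightarrow>
     finite (vertices G)
     \<and> edges G \<subseteq> {{u, v} |u v. u \<in> vertices G \<and> v \<in> vertices G \<and> u \<noteq> v}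
     \<and> (\<forall>u\<in>vertices G. \<forall>v\<in>vertices G. (u, v) \<in> {(x, y). {x, y} \<in> edges G}\<^sup>*)
     \<and> (\<forall>e\<in>edges G. vertices G \<inter> edge_points G e = {})
     \<and> disjoint_family_on (edge_points G) (edges G)
     \<and> (\<forall>e\<in>edges G. inj_on (chart G e) (edge_points G e \<union> e)
          \<and> (\<exists>a b. a < b \<and> chart G e ` edge_points G e = {a<..<b} \<and> chart G e ` e = {a, b}))"

definition points :: "'a egraph \<Rightarrow> 'a set" where
  "points G = vertices G \<union> (\<Union>e\<in>edges G. edge_points G e)"

text \<open>The end points of the interval onto which an edge is mapped, and its length.\<close>

definition edge_lo :: "'a egraph \<Rightarrow> 'a set \<Rightarrow> real" where
  "edge_lo G e = Min (chart G e ` e)"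

definition edge_hi :: "'a egraph \<Rightarrow> 'a set \<Rightarrow> real" where
  "edge_hi G e = Max (chart G e ` e)"

definition edge_length :: "'a egraph \<Rightarrow> 'a set \<Rightarrow> real" where
  "edge_length G e = edge_hi G e - edge_lo G e"

definition host_edge :: "'a egraph \<Rightarrow> 'a \<Rightarrow> 'a set" where
  "host_edge G u = (THE e. e \<in> edges G \<and> u \<in> edge_points G e)"

definition lower_vertex :: "'a egraph \<Rightarrow> 'a \<Rightarrow> 'a" where
  "lower_vertex G u = (if u \<in> vertices G then u
     else (THE v. v \<in> host_edge G u \<and> chart G (host_edge G u) v = edge_lo G (host_edge G u)))"

definition upper_vertex :: "'a egraph \<Rightarrow> 'a \<Rightarrow> 'a" where
  "upper_vertex G u = (if u \<in> vertices G then u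
     else (THE v. v \<in> host_edge G u \<and> chart G (host_edge G u) v = edge_hi G (host_edge G u)))"

definition rel_position :: "'a egraph \<Rightarrow> 'a \<Rightarrow> real" where
  "rel_position G u = (if u \<in> vertices G then 0
     else \<bar>chart G (host_edge G u) u - edge_lo G (host_edge G u)\<bar> / edge_length G (host_edge G u))"

section \<open>The matrix L\<close>

definition conductance :: "'a egraph \<Rightarrow> 'a \<Rightarrow> 'a \<Rightarrow> real" where
  "conductance G u v = (if {u, v} \<in> edges G then 1 / edge_length G {u, v} else 0)"

definition total_conductance :: "'a egraph \<Rightarrow> 'a \<Rightarrow> real" where
  "total_conductance G u = (\<Sum>v\<in>vertices G. conductance G u v)"

definition laplacian :: "'a egraph \<Rightarrow> 'a \<Rightarrow> 'a \<Rightarrow> 'a \<Rightarrow> real" where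
  "laplacian G u0 u v =
     (if u = v then (if u = u0 then 1 + total_conductance G u0 else total_conductance G u)
      else - conductance G u v)"

definition inverse_matrix_on :: "'a set \<Rightarrow> ('a \<Rightarrow> 'a \<Rightarrow> real) \<Rightarrow> ('a \<Rightarrow> 'a \<Rightarrow> real) \<Rightarrow> bool" where
  "inverse_matrix_on V A S \<longleftrightarrow>
     (\<forall>u\<in>V. \<forall>v\<in>V. (\<Sum>w\<in>V. A u w * S w v) = (if u = v then 1 else 0)
                 \<and> (\<Sum>w\<in>V. S u w * A w v) = (if u = v then 1 else 0))"

section \<open>Gaussian families and generated events\<close>

text \<open>The normal law with mean m and variance s; a point mass if s = 0.\<close>

definition normal_law :: "real \<Rightarrow> real \<Rightarrow> real measure" where
  "normal_law m s = (if s = 0 then return borel m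
     else density lborel (\<lambda>x. ennreal (normal_density m (sqrt s) x)))"

text \<open>
  Centred Gaussian family with covariance kernel S: every finite linear combination is
  univariate normal, degenerate laws being allowed. For a finite index set I this is N(0, S).
\<close>

definition centred_gaussian ::
  "'w measure \<Rightarrow> 'i set \<Rightarrow> ('i \<Rightarrow> 'w \<Rightarrow> real) \<Rightarrow> ('i \<Rightarrow> 'i \<Rightarrow> real) \<Rightarrow> bool" where
  "centred_gaussian M I X S \<longleftrightarrow>
     (\<forall>i\<in>I. X i \<in> borel_measurable M)
     \<and> (\<forall>J a. finite J \<and> J \<subseteq> I \<longrightarrow>
          distr M borel (\<lambda>\<omega>. \<Sum>i\<in>J. a i * X i \<omega>)
            = normal_law 0 (\<Sum>i\<in>J. \<Sum>j\<in>J. a i * a j * S i j))"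

definition brownian_bridge :: "'w measure \<Rightarrow> real \<Rightarrow> real \<Rightarrow> (real \<Rightarrow> 'w \<Rightarrow> real) \<Rightarrow> bool" where
  "brownian_bridge M a b B \<longleftrightarrow>
     centred_gaussian M {a..b} B (\<lambda>s t. (min s t - a) * (b - max s t) / (b - a))
     \<and> (AE \<omega> in M. continuous_on {a..b} (\<lambda>t. B t \<omega>) \<and> B a \<omega> = 0 \<and> B b \<omega> = 0)"

definition generated_events :: "'w measure \<Rightarrow> 'i set \<Rightarrow> ('i \<Rightarrow> 'w \<Rightarrow> real) \<Rightarrow> 'w set set" where
  "generated_events M I X =
     sigma_sets (space M) {X i -` A \<inter> space M |i A. i \<in> I \<and> A \<in> sets borel}"

section \<open>The auxiliary field and the resistance metric\<close>

definition vertex_field :: "'a egraph \<Rightarrow> ('a \<Rightarrow> 'w \<Rightarrow> real) \<Rightarrow> 'a \<Rightarrow> 'w \<Rightarrow> real" where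
  "vertex_field G Zmu u \<omega> = (1 - rel_position G u) * Zmu (lower_vertex G u) \<omega>
                         + rel_position G u * Zmu (upper_vertex G u) \<omega>"

definition edge_field ::
  "'a egraph \<Rightarrow> ('a set \<Rightarrow> real \<Rightarrow> 'w \<Rightarrow> real) \<Rightarrow> 'a set \<Rightarrow> 'a \<Rightarrow> 'w \<Rightarrow> real" where
  "edge_field G B e u \<omega> = (if u \<in> edge_points G e then B e (chart G e u) \<omega> else 0)"

text \<open>
  Zmu gives the Gaussian vector on the vertices (index None below), B e the bridge of the edge e
  (index Some e).
\<close>

definition auxiliary_field :: "'w measure \<Rightarrow> 'a egraph \<Rightarrow> 'a \<Rightarrow> ('a \<Rightarrow> 'w \<Rightarrow> real) \<Rightarrow> bool" where
  "auxiliary_field M G u0 Z \<longleftrightarrow> (\<exists>Zmu B S.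
     inverse_matrix_on (vertices G) (laplacian G u0) S
     \<and> centred_gaussian M (vertices G) Zmu S
     \<and> (\<forall>e\<in>edges G. brownian_bridge M (edge_lo G e) (edge_hi G e) (B e))
     \<and> prob_space.indep_sets M
          (case_option (generated_events M (vertices G) Zmu)
             (\<lambda>e. generated_events M {edge_lo G e..edge_hi G e} (B e)))
          (insert None (Some ` edges G))
     \<and> (\<forall>u\<in>points G. \<forall>\<omega>\<in>space M.
          Z u \<omega> = vertex_field G Zmu u \<omega> + (\<Sum>e\<in>edges G. edge_field G B e u \<omega>)))"

definition resistance_metric :: "'w measure \<Rightarrow> ('a \<Rightarrow> 'w \<Rightarrow> real) \<Rightarrow> 'a \<Rightarrow> 'a \<Rightarrow> real" where
  "resistance_metric M Z u v = prob_space.variance M (\<lambda>\<omega>. Z u \<omega> - Z v \<omega>)"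

section \<open>Poisson points and random signs\<close>

definition poisson_process :: "'w measure \<Rightarrow> real \<Rightarrow> ('w \<Rightarrow> real set) \<Rightarrow> bool" where
  "poisson_process M r X \<longleftrightarrow>
     (\<forall>\<omega>\<in>space M. \<forall>A. bounded A \<longrightarrow> finite (X \<omega> \<inter> A))
     \<and> (\<forall>A\<in>sets borel. bounded A \<longrightarrow>
          (\<lambda>\<omega>. card (X \<omega> \<inter> A)) \<in> measurable M (count_space UNIV)
          \<and> (\<forall>n. measure M {\<omega> \<in> space M. card (X \<omega> \<inter> A) = n}
                 = (r * measure lborel A) ^ n / fact n * exp (- (r * measure lborel A))))
     \<and> (\<forall>A :: nat \<Rightarrow> real set. disjoint_family A \<and> (\<forall>i. A i \<in> sets borel \<and> bounded (A i)) \<longrightarrow>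
          prob_space.indep_vars M (\<lambda>_. count_space UNIV) (\<lambda>i \<omega>. card (X \<omega> \<inter> A i)) UNIV)"

definition point_events :: "'w measure \<Rightarrow> ('w \<Rightarrow> real set) \<Rightarrow> 'w set set" where
  "point_events M X =
     sigma_sets (space M)
       {{\<omega> \<in> space M. card (X \<omega> \<inter> A) = n} |A n. A \<in> sets borel \<and> bounded A}"

definition random_signs :: "'w measure \<Rightarrow> 'i set \<Rightarrow> ('i \<Rightarrow> 'w \<Rightarrow> real) \<Rightarrow> bool" where
  "random_signs M I \<eta> \<longleftrightarrow>
     prob_space.indep_vars M (\<lambda>_. borel) \<eta> I
     \<and> (\<forall>i\<in>I. measure M {\<omega> \<in> space M. \<eta> i \<omega> = 1} = 1 / 2
             \<and> measure M {\<omega> \<in> space M. \<eta> i \<omega> = - 1} = 1 / 2)"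

text \<open>
  A measurable enumeration without repetition of the points of X. It uses all indices where X is
  infinite and the indices below card X where X is finite.
\<close>

definition enumerates :: "'w measure \<Rightarrow> ('w \<Rightarrow> real set) \<Rightarrow> (nat \<Rightarrow> 'w \<Rightarrow> real) \<Rightarrow> bool" where
  "enumerates M X \<xi> \<longleftrightarrow>
     (\<forall>k. \<xi> k \<in> borel_measurable M)
     \<and> (\<forall>\<omega>\<in>space M.
          bij_betw (\<lambda>k. \<xi> k \<omega>) {k. finite (X \<omega>) \<longrightarrow> k < card (X \<omega>)} (X \<omega>))"

text \<open>
  Random signs indexed by the real line, independent of the point process X and of the events F
  of another process. Independence of the uncountable family (eps x) and X only sees eps at
  countably many deterministic positions, hence it says nothing about the marks eps x that are
  read at the random points x of X: changing eps to be constantly 1 on X affects no fixed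
  eps x with positive probability. The last conjunct is the usual meaning of independent marks:
  along a measurable enumeration of X, the marks are independent random signs, independent of the
  points and of F.
\<close>

definition independent_signs ::
  "'w measure \<Rightarrow> ('w \<Rightarrow> real set) \<Rightarrow> 'w set set \<Rightarrow> (real \<Rightarrow> 'w \<Rightarrow> real) \<Rightarrow> bool" where
  "independent_signs M X F eps \<longleftrightarrow>
     random_signs M UNIV eps
     \<and> prob_space.indep_set M (generated_events M UNIV eps)
          (sigma_sets (space M) (point_events M X \<union> F))
     \<and> (\<exists>\<xi>. enumerates M X \<xi>
          \<and> random_signs M UNIV (\<lambda>k \<omega>. eps (\<xi> k \<omega>) \<omega>)
          \<and> prob_space.indep_set M (generated_events M UNIV (\<lambda>k \<omega>. eps (\<xi> k \<omega>) \<omega>))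
               (sigma_sets (space M) (generated_events M UNIV \<xi> \<union> F)))"

section \<open>The random field Y, covariances and the covariogram\<close>

text \<open>
  For square-integrable f the sum over the points of X need not converge absolutely; it is the
  limit of the finite sums over the points in the windows [-n, n].
\<close>

definition window_sum ::
  "('w \<Rightarrow> real set) \<Rightarrow> (real \<Rightarrow> 'w \<Rightarrow> real) \<Rightarrow> (real \<Rightarrow> real) \<Rightarrow> ('a \<Rightarrow> 'w \<Rightarrow> real) \<Rightarrow> nat \<Rightarrow> 'a \<Rightarrow> 'w \<Rightarrow> real"
where
  "window_sum X eps f Z n u \<omega> =
     (\<Sum>x\<in>X \<omega> \<inter> {- real n..real n}. eps x \<omega> * f (Z u \<omega> - x))"

definition poisson_field ::
  "('w \<Rightarrow> real set) \<Rightarrow> (real \<Rightarrow> 'w \<Rightarrow> real) \<Rightarrow> (real \<Rightarrow> real) \<Rightarrow> ('a \<Rightarrow> 'w \<Rightarrow> real) \<Rightarrow> 'a \<Rightarrow> 'w \<Rightarrow> real"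
where
  "poisson_field X eps f Z u \<omega> = lim (\<lambda>n. window_sum X eps f Z n u \<omega>)"

definition covariance :: "'w measure \<Rightarrow> ('w \<Rightarrow> real) \<Rightarrow> ('w \<Rightarrow> real) \<Rightarrow> real" where
  "covariance M U V =
     prob_space.expectation M (\<lambda>\<omega>. (U \<omega> - prob_space.expectation M U)
                                 * (V \<omega> - prob_space.expectation M V))"

definition covariogram :: "(real \<Rightarrow> real) \<Rightarrow> real \<Rightarrow> real" where
  "covariogram f h = (LINT x|lborel. f (x + h) * f x)"

end

theory Submission
  imports Defs
begin

text \<open>
  Given the points of X and the field Z, the marks along an enumeration of X are i.i.d. signs, so
  that Y(u) is a series with independent centred terms and square summable coefficients f(Z(u) - x).
  Kolmogorov's maximal inequality gives its almost sure convergence along the windows, and the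
  orthogonality of the signs gives the conditional covariance as the sum over x of
  f(Z(u) - x) f(Z(v) - x). By Campbell's formula its expectation is
  E[covariogram f (Z(u) - Z(v))]. Finally Z(u) - Z(v) is a sum of independent centred Gaussian
  variables, hence normal with variance dR(u, v).
\<close>

section \<open>Square-integrable functions\<close>

text \<open>Without absolute convergence the order of summation matters, and the cancellation must
  come from the signs. The windows select index sets of the enumeration that depend on the points
  but not on the signs, so random series are treated along arbitrary increasing finite index sets
  instead of initial segments. Conditioning is done without conditional expectations. The points
  together with the field on one side and the sign sequence on the other have a product law; hence
  points and field can be read at a sample \<omega> and the signs at an independent \<omega>', and
  Fubini returns to the diagonal. An enumeration may order the points in a way that depends on
  \<open>Z\<close>, so single points \<open>\<xi> k\<close> cannot be treated as independent of
  \<open>Z\<close>. Campbell's formula therefore rests on counts in bounded sets, which do not see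
  the order. It serves twice: for squares it gives the almost sure summability of the coefficients,
  and for products it gives the covariance. Since \<open>dR\<close> is by definition the variance of
  an increment, normality alone determines the law of that increment from \<open>dR\<close>; this is
  the source of isotropy.\<close>

lemma abs_mult_le_sum_squares: "\<bar>x * y\<bar> \<le> x\<^sup>2 + (y :: real)\<^sup>2"
proof -
  have "2 * \<bar>x\<bar> * \<bar>y\<bar> \<le> x\<^sup>2 + y\<^sup>2" using sum_squares_bound[of "\<bar>x\<bar>" "\<bar>y\<bar>"] by simp
  moreover have "0 \<le> \<bar>x\<bar> * \<bar>y\<bar>" by simp
  ultimately show ?thesis unfolding abs_mult by linarith
qed

lemma integrable_mult_square:
  fixes f g :: "'a \<Rightarrow> real"
  assumes [measurable]: "f \<in> borel_measurable M" "g \<in> borel_measurable M"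
    and "integrable M (\<lambda>x. (f x)\<^sup>2)" "integrable M (\<lambda>x. (g x)\<^sup>2)"
  shows "integrable M (\<lambda>x. f x * g x)"
proof (rule Bochner_Integration.integrable_bound)
  show "integrable M (\<lambda>x. (f x)\<^sup>2 + (g x)\<^sup>2)" using assms by simp
  show "AE x in M. norm (f x * g x) \<le> norm ((f x)\<^sup>2 + (g x)\<^sup>2)"
    using abs_mult_le_sum_squares by (intro AE_I2) simp
qed simp

lemma integrable_add_square:
  fixes f g :: "'a \<Rightarrow> real"
  assumes [measurable]: "f \<in> borel_measurable M" "g \<in> borel_measurable M"
    and "integrable M (\<lambda>x. (f x)\<^sup>2)" "integrable M (\<lambda>x. (g x)\<^sup>2)"
  shows "integrable M (\<lambda>x. (f x + g x)\<^sup>2)"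
  using integrable_mult_square[OF assms] assms(3,4)
  by (simp add: power2_sum mult.assoc)

text \<open>The quadratic polynomial \<open>t\<^sup>2 * A + 2 * t * C + B\<close> is the integral of
  \<open>(t * f x + g x)\<^sup>2\<close>, hence nonnegative for every \<open>t\<close>; the
  inequality is its discriminant condition.\<close>

lemma Cauchy_Schwarz_integral:
  fixes f g :: "'a \<Rightarrow> real"
  assumes [measurable]: "f \<in> borel_measurable M" "g \<in> borel_measurable M"
    and "integrable M (\<lambda>x. (f x)\<^sup>2)" "integrable M (\<lambda>x. (g x)\<^sup>2)"
  shows "(LINT x|M. f x * g x)\<^sup>2 \<le> (LINT x|M. (f x)\<^sup>2) * (LINT x|M. (g x)\<^sup>2)"
proof -
  define A B C where "A = (LINT x|M. (f x)\<^sup>2)" and "B = (LINT x|M. (g x)\<^sup>2)"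
    and "C = (LINT x|M. f x * g x)"
  have nonneg: "0 \<le> t\<^sup>2 * A + 2 * t * C + B" for t
  proof -
    have "0 \<le> (LINT x|M. (t * f x + g x)\<^sup>2)" by simp
    also have "(\<lambda>x. (t * f x + g x)\<^sup>2) = (\<lambda>x. t\<^sup>2 * (f x)\<^sup>2 + 2 * t * (f x * g x) + (g x)\<^sup>2)"
      by (simp add: power2_eq_square algebra_simps)
    finally show ?thesis
      using assms integrable_mult_square[OF assms] by (simp add: A_def B_def C_def)
  qed
  have "0 \<le> A" by (simp add: A_def)
  show ?thesis
  proof (cases "A = 0")
    case True
    have "C = 0"
    proof (rule ccontr)
      assume "C \<noteq> 0"
      \<comment> \<open>For \<open>A = 0\<close> the polynomial is affine in \<open>t\<close>; this
        value of \<open>t\<close> is chosen so that it equals -1.\<close>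
      then show False using nonneg[of "- (B + 1) / (2 * C)"] True by (simp add: field_simps)
    qed
    then show ?thesis using True by (simp add: A_def C_def)
  next
    case False
    then have "0 < A" using \<open>0 \<le> A\<close> by simp
    \<comment> \<open>\<open>- C / A\<close> is the minimiser of the quadratic polynomial.\<close>
    then have "0 \<le> B - C\<^sup>2 / A"
      using nonneg[of "- C / A"] by (simp add: power2_eq_square)
    then show ?thesis
      using \<open>0 < A\<close> by (simp add: A_def[symmetric] B_def[symmetric] C_def[symmetric] field_simps)
  qed
qed

text \<open>Expand \<open>F n * G n\<close> around \<open>f * g\<close>: the three error terms
  \<open>(F n - f) * (G n - g)\<close>, \<open>f * (G n - g)\<close> and
  \<open>(F n - f) * g\<close> vanish by Cauchy-Schwarz. This carries means and covariances from
  partial sums to limits of random series.\<close>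

lemma tendsto_integral_mult_L2:
  fixes f g :: "'a \<Rightarrow> real" and F G :: "nat \<Rightarrow> 'a \<Rightarrow> real"
  assumes [measurable]: "f \<in> borel_measurable M" "g \<in> borel_measurable M"
      "\<And>n. F n \<in> borel_measurable M" "\<And>n. G n \<in> borel_measurable M"
    and sq: "integrable M (\<lambda>x. (f x)\<^sup>2)" "integrable M (\<lambda>x. (g x)\<^sup>2)"
      "\<And>n. integrable M (\<lambda>x. (F n x)\<^sup>2)" "\<And>n. integrable M (\<lambda>x. (G n x)\<^sup>2)"
    and lim: "(\<lambda>n. LINT x|M. (F n x - f x)\<^sup>2) \<longlonglongrightarrow> 0" "(\<lambda>n. LINT x|M. (G n x - g x)\<^sup>2) \<longlonglongrightarrow> 0"
  shows "(\<lambda>n. LINT x|M. F n x * G n x) \<longlonglongrightarrow> (LINT x|M. f x * g x)"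
proof -
  have dsq: "integrable M (\<lambda>x. (F n x - f x)\<^sup>2)" "integrable M (\<lambda>x. (G n x - g x)\<^sup>2)" for n
    using integrable_add_square[of "F n" M "\<lambda>x. - f x"] integrable_add_square[of "G n" M "\<lambda>x. - g x"] sq
    by auto
  have zero: "(\<lambda>n. LINT x|M. U n x * V n x) \<longlonglongrightarrow> 0"
    if [measurable]: "\<And>n. U n \<in> borel_measurable M" "\<And>n. V n \<in> borel_measurable M"
      and s: "\<And>n. integrable M (\<lambda>x. (U n x)\<^sup>2)" "\<And>n. integrable M (\<lambda>x. (V n x)\<^sup>2)"
      and l: "(\<lambda>n. (LINT x|M. (U n x)\<^sup>2) * (LINT x|M. (V n x)\<^sup>2)) \<longlonglongrightarrow> 0"
    for U V :: "nat \<Rightarrow> 'a \<Rightarrow> real"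
  proof (rule Lim_null_comparison)
    show "(\<lambda>n. sqrt ((LINT x|M. (U n x)\<^sup>2) * (LINT x|M. (V n x)\<^sup>2))) \<longlonglongrightarrow> 0"
      using tendsto_real_sqrt[OF l] by simp
    show "\<forall>\<^sub>F n in sequentially. norm (LINT x|M. U n x * V n x)
        \<le> sqrt ((LINT x|M. (U n x)\<^sup>2) * (LINT x|M. (V n x)\<^sup>2))"
    proof (intro always_eventually allI real_le_rsqrt)
      show "(norm (LINT x|M. U n x * V n x))\<^sup>2 \<le> (LINT x|M. (U n x)\<^sup>2) * (LINT x|M. (V n x)\<^sup>2)" for n
        using Cauchy_Schwarz_integral[of "U n" M "V n"] s by simp
    qed
  qed
  have "(\<lambda>n. (LINT x|M. (F n x - f x) * (G n x - g x)) + (LINT x|M. f x * (G n x - g x))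
      + (LINT x|M. (F n x - f x) * g x) + (LINT x|M. f x * g x)) \<longlonglongrightarrow> 0 + 0 + 0 + (LINT x|M. f x * g x)"
    using lim
    by (intro tendsto_add zero tendsto_const)
       (auto simp: sq dsq intro: tendsto_eq_intros)
  also have "(\<lambda>n. (LINT x|M. (F n x - f x) * (G n x - g x)) + (LINT x|M. f x * (G n x - g x))
      + (LINT x|M. (F n x - f x) * g x) + (LINT x|M. f x * g x)) = (\<lambda>n. LINT x|M. F n x * G n x)"
  proof
    fix n
    have "integrable M (\<lambda>x. (F n x - f x) * (G n x - g x))" "integrable M (\<lambda>x. f x * (G n x - g x))"
      "integrable M (\<lambda>x. (F n x - f x) * g x)" "integrable M (\<lambda>x. f x * g x)"
      by (rule integrable_mult_square; simp add: sq dsq)+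
    note * = this
    have "(LINT x|M. F n x * G n x) = (LINT x|M. (F n x - f x) * (G n x - g x) + f x * (G n x - g x)
        + (F n x - f x) * g x + f x * g x)"
      by (simp add: algebra_simps)
    then show "(LINT x|M. (F n x - f x) * (G n x - g x)) + (LINT x|M. f x * (G n x - g x))
      + (LINT x|M. (F n x - f x) * g x) + (LINT x|M. f x * g x) = (LINT x|M. F n x * G n x)"
      using * by (simp only: Bochner_Integration.integral_add Bochner_Integration.integrable_add)
  qed
  finally show ?thesis by simp
qed

text \<open>Absolute summability is unconditional summability, so the limit exists along the filter
  of all finite subsets, and an exhausting sequence of finite sets converges along that filter. This
  generality is needed because windows collect the indices of an enumeration in no particular
  order.\<close>

lemma tendsto_sum_exhaustion:
  fixes f :: "nat \<Rightarrow> real"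
  assumes "summable (\<lambda>k. \<bar>f k\<bar>)" "incseq I" "\<And>n. finite (I n)" "(\<Union>n. I n) = UNIV"
  shows "(\<lambda>n. \<Sum>k\<in>I n. f k) \<longlonglongrightarrow> (\<Sum>k. f k)"
proof -
  have "(f has_sum (\<Sum>k. f k)) UNIV"
    using assms(1) by (intro norm_summable_imp_has_sum summable_sums) (auto dest: summable_rabs_cancel)
  moreover have "filterlim I (finite_subsets_at_top UNIV) sequentially"
    unfolding filterlim_finite_subsets_at_top
  proof safe
    fix X :: "nat set" assume "finite X"
    then have "\<exists>n. X \<subseteq> I n"
    proof induction
      case (insert x X)
      then obtain n where "X \<subseteq> I n" by blast
      moreover obtain m where "x \<in> I m" using assms(4) by auto
      ultimately have "insert x X \<subseteq> I (max m n)"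
        using incseqD[OF assms(2), of m "max m n"] incseqD[OF assms(2), of n "max m n"] by auto
      then show ?case ..
    qed simp
    then obtain n where "X \<subseteq> I n" ..
    then have "\<forall>m\<ge>n. X \<subseteq> I m" using assms(2) by (auto dest: incseqD)
    then show "\<forall>\<^sub>F n in sequentially. finite (I n) \<and> X \<subseteq> I n \<and> I n \<subseteq> UNIV"
      using assms(3) by (auto simp: eventually_sequentially)
  qed
  ultimately show ?thesis
    unfolding has_sum_def by (rule filterlim_compose)
qed

section \<open>Series of independent terms with random signs\<close>

text \<open>Random signs enter the theory of the series only through independence and their first
  two moments, so these are isolated here.\<close>

locale orthonormal_noise = prob_space M for M :: "'w measure" +
  fixes \<eta> :: "nat \<Rightarrow> 'w \<Rightarrow> real"
  assumes indep: "indep_vars (\<lambda>_. borel) \<eta> UNIV"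
    and square_integrable: "\<And>k. integrable M (\<lambda>\<omega>. (\<eta> k \<omega>)\<^sup>2)"
    and mean: "\<And>k. expectation (\<eta> k) = 0"
    and second_moment: "\<And>k. expectation (\<lambda>\<omega>. (\<eta> k \<omega>)\<^sup>2) = 1"
begin

lemma noise_measurable [measurable]: "\<eta> k \<in> borel_measurable M"
  using indep by (auto simp: indep_vars_def)

lemma integrable_noise: "integrable M (\<eta> k)"
  using square_integrable_imp_integrable[OF noise_measurable square_integrable] .

lemma indep_noise_functionals:
  assumes "A \<inter> B = {}" "g \<in> borel_measurable (PiM A (\<lambda>_. borel))"
    "h \<in> borel_measurable (PiM B (\<lambda>_. borel))"
  shows "indep_var borel (\<lambda>\<omega>. g (\<lambda>i\<in>A. \<eta> i \<omega>)) borel (\<lambda>\<omega>. h (\<lambda>i\<in>B. \<eta> i \<omega>) :: real)"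
  using indep_var_compose[OF indep_var_restrict[OF indep assms(1)] assms(2,3)]
  by (simp add: comp_def)

lemma indep_noise_pair:
  assumes "j \<noteq> k"
  shows "indep_var borel (\<eta> j) borel (\<eta> k)"
proof -
  have "indep_var borel (\<lambda>\<omega>. (\<lambda>x. x j) (\<lambda>i\<in>{j}. \<eta> i \<omega>)) borel (\<lambda>\<omega>. (\<lambda>x. x k) (\<lambda>i\<in>{k}. \<eta> i \<omega>))"
    by (rule indep_noise_functionals) (use assms in auto)
  then show ?thesis by simp
qed

lemma integrable_noise_mult: "integrable M (\<lambda>\<omega>. \<eta> j \<omega> * \<eta> k \<omega>)"
  and expectation_noise_mult: "expectation (\<lambda>\<omega>. \<eta> j \<omega> * \<eta> k \<omega>) = of_bool (j = k)"
proof -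
  have "integrable M (\<lambda>\<omega>. \<eta> j \<omega> * \<eta> k \<omega>) \<and> expectation (\<lambda>\<omega>. \<eta> j \<omega> * \<eta> k \<omega>) = of_bool (j = k)"
  proof (cases "j = k")
    case True
    then show ?thesis
      using square_integrable[of k] second_moment[of k] by (simp add: power2_eq_square)
  next
    case False
    then show ?thesis
      using indep_var_integrable[OF indep_noise_pair integrable_noise integrable_noise]
        indep_var_lebesgue_integral[OF indep_noise_pair integrable_noise integrable_noise]
      by (simp add: mean)
  qed
  then show "integrable M (\<lambda>\<omega>. \<eta> j \<omega> * \<eta> k \<omega>)"
    and "expectation (\<lambda>\<omega>. \<eta> j \<omega> * \<eta> k \<omega>) = of_bool (j = k)" by auto
qed

definition weighted_sum :: "(nat \<Rightarrow> real) \<Rightarrow> nat set \<Rightarrow> 'w \<Rightarrow> real" where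
  "weighted_sum a I \<omega> = (\<Sum>k\<in>I. a k * \<eta> k \<omega>)"

lemma weighted_sum_measurable [measurable]: "weighted_sum a I \<in> borel_measurable M"
  unfolding weighted_sum_def by measurable

lemma expectation_weighted_sum: "expectation (weighted_sum a I) = 0"
  unfolding weighted_sum_def
  by (subst Bochner_Integration.integral_sum) (auto simp: mean integrable_noise)

lemma weighted_sum_mult:
  "weighted_sum a I \<omega> * weighted_sum b J \<omega> = (\<Sum>j\<in>I. \<Sum>k\<in>J. a j * b k * (\<eta> j \<omega> * \<eta> k \<omega>))"
  unfolding weighted_sum_def by (simp add: sum_product mult_ac)

lemma integrable_weighted_sum_mult: "integrable M (\<lambda>\<omega>. weighted_sum a I \<omega> * weighted_sum b J \<omega>)"
  unfolding weighted_sum_mult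
  by (intro Bochner_Integration.integrable_sum integrable_mult_right integrable_noise_mult)

lemma integrable_weighted_sum_square: "integrable M (\<lambda>\<omega>. (weighted_sum a I \<omega>)\<^sup>2)"
  using integrable_weighted_sum_mult[of a I a I] by (simp add: power2_eq_square)

lemma expectation_weighted_sum_mult:
  assumes "finite I"
  shows "expectation (\<lambda>\<omega>. weighted_sum a I \<omega> * weighted_sum b I \<omega>) = (\<Sum>k\<in>I. a k * b k)"
proof -
  have "expectation (\<lambda>\<omega>. weighted_sum a I \<omega> * weighted_sum b I \<omega>)
      = (\<Sum>j\<in>I. \<Sum>k\<in>I. a j * b k * of_bool (j = k))"
    unfolding weighted_sum_mult
    by (simp add: Bochner_Integration.integral_sum integrable_noise_mult expectation_noise_mult)
  also have "\<dots> = (\<Sum>j\<in>I. a j * b j)"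
    using assms by (intro sum.cong) (auto simp: of_bool_def if_distrib[of "\<lambda>x. _ * x"] cong: if_cong)
  finally show ?thesis .
qed

lemma expectation_weighted_sum_square:
  "finite I \<Longrightarrow> expectation (\<lambda>\<omega>. (weighted_sum a I \<omega>)\<^sup>2) = (\<Sum>k\<in>I. (a k)\<^sup>2)"
  using expectation_weighted_sum_mult[of I a a] by (simp add: power2_eq_square)

lemma weighted_sum_diff:
  "finite J \<Longrightarrow> I \<subseteq> J \<Longrightarrow> weighted_sum a J \<omega> - weighted_sum a I \<omega> = weighted_sum a (J - I) \<omega>"
  unfolding weighted_sum_def by (simp add: sum_diff)

text \<open>Split according to the first \<open>j\<close> with
  \<open>\<epsilon> \<le> \<bar>S j \<omega>\<bar>\<close>. On that event
  \<open>(S n)\<^sup>2\<close> is at least \<open>(S j)\<^sup>2 + 2 * (S j * (S n - S j))\<close>,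
  and the cross term has mean zero because \<open>S n - S j\<close> involves only noise outside
  \<open>I j\<close>.\<close>

lemma Kolmogorov_maximal_inequality:
  assumes I: "incseq I" "\<And>n. finite (I n)" and "\<epsilon> > 0"
  shows "prob {\<omega> \<in> space M. \<exists>j\<le>n. \<epsilon> \<le> \<bar>weighted_sum a (I j) \<omega>\<bar>} \<le> (\<Sum>k\<in>I n. (a k)\<^sup>2) / \<epsilon>\<^sup>2"
proof -
  define S where "S j = weighted_sum a (I j)" for j
  define T where "T j \<omega> \<longleftrightarrow> \<epsilon> \<le> \<bar>S j \<omega>\<bar> \<and> (\<forall>i\<in>{..<j}. \<bar>S i \<omega>\<bar> < \<epsilon>)" for j \<omega>
  define A where "A j = {\<omega> \<in> space M. T j \<omega>}" for j
  have [measurable]: "S j \<in> borel_measurable M" for j by (simp add: S_def)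
  have A_sets [measurable]: "A j \<in> sets M" for j unfolding A_def T_def by measurable
  have int_S: "integrable M (\<lambda>\<omega>. (S j \<omega>)\<^sup>2)" for j
    by (simp add: S_def integrable_weighted_sum_square)
  have disj: "disjoint_family A"
    unfolding disjoint_family_on_def A_def T_def 
    by (auto simp: not_less[symmetric]) (metis lessThan_iff linorder_neqE_nat)
  have step: "\<epsilon>\<^sup>2 * prob (A j) \<le> expectation (\<lambda>\<omega>. indicator (A j) \<omega> * (S n \<omega>)\<^sup>2)" if "j \<le> n" for j
  proof -
    \<comment> \<open>The event A j and S j depend only on the terms in I j, while S n - S j depends on those in I n - I j.\<close>
    define s where "s i x = (\<Sum>k\<in>I i \<inter> I j. a k * x k)" for i :: nat and x :: "nat \<Rightarrow> real"
    define g where "g x = (if \<epsilon> \<le> \<bar>s j x\<bar> \<and> (\<forall>i\<in>{..<j}. \<bar>s i x\<bar> < \<epsilon>) then s j x else 0)" for x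
    define h where "h x = (\<Sum>k\<in>I n - I j. a k * x k)" for x :: "nat \<Rightarrow> real"
    have [measurable]: "s i \<in> borel_measurable (PiM (I j) (\<lambda>_. borel))" for i
      unfolding s_def by (intro borel_measurable_sum borel_measurable_times) auto
    have g: "g \<in> borel_measurable (PiM (I j) (\<lambda>_. borel))" unfolding g_def by measurable
    have h: "h \<in> borel_measurable (PiM (I n - I j) (\<lambda>_. borel))"
      unfolding h_def by (intro borel_measurable_sum borel_measurable_times) auto
    \<comment> \<open>Intersecting with \<open>I j\<close> in \<open>s\<close> makes it a function
      of the coordinates in \<open>I j\<close> for every \<open>i\<close>; for
      \<open>i \<le> j\<close> monotonicity gives \<open>I i \<subseteq> I j\<close>, and nothing is
      lost.\<close>
    have s_eq: "s i (\<lambda>k\<in>I j. \<eta> k \<omega>) = S i \<omega>" if "i \<le> j" for i \<omega>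
      using incseqD[OF I(1) that] unfolding s_def S_def weighted_sum_def
      by (intro sum.cong) auto
    have g_eq: "g (\<lambda>k\<in>I j. \<eta> k \<omega>) = indicator (A j) \<omega> * S j \<omega>" if "\<omega> \<in> space M" for \<omega>
      using that unfolding g_def A_def T_def by (auto simp: s_eq indicator_def)
    have h_eq: "h (\<lambda>k\<in>I n - I j. \<eta> k \<omega>) = S n \<omega> - S j \<omega>" for \<omega>
      using weighted_sum_diff[OF I(2) incseqD[OF I(1) \<open>j \<le> n\<close>], of a \<omega>]
      unfolding h_def S_def by (simp add: weighted_sum_def)
    have ind: "indep_var borel (\<lambda>\<omega>. g (\<lambda>k\<in>I j. \<eta> k \<omega>)) borel (\<lambda>\<omega>. h (\<lambda>k\<in>I n - I j. \<eta> k \<omega>))"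
      by (rule indep_noise_functionals[OF _ g h]) auto
    have S_int: "integrable M (S i)" for i
      by (rule square_integrable_imp_integrable) (auto intro: int_S)
    have ig: "integrable M (\<lambda>\<omega>. g (\<lambda>k\<in>I j. \<eta> k \<omega>))"
      using integrable_mult_indicator[OF A_sets S_int, of j j]
      by (subst Bochner_Integration.integrable_cong[OF refl g_eq]) auto
    have ih: "integrable M (\<lambda>\<omega>. h (\<lambda>k\<in>I n - I j. \<eta> k \<omega>))"
      unfolding h_eq by (intro Bochner_Integration.integrable_diff S_int)
    have m0: "expectation (\<lambda>\<omega>. h (\<lambda>k\<in>I n - I j. \<eta> k \<omega>)) = 0"
      unfolding h_eq using S_int by (simp add: S_def expectation_weighted_sum)
    \<comment> \<open>This is the cross term \<open>indicator (A j) * S j * (S n - S j)\<close>, a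
      product of independent integrable factors, the second one centred.\<close>
    define c where "c \<omega> = g (\<lambda>k\<in>I j. \<eta> k \<omega>) * h (\<lambda>k\<in>I n - I j. \<eta> k \<omega>)" for \<omega>
    have c: "integrable M c" "expectation c = 0"
      unfolding c_def using indep_var_integrable[OF ind ig ih] indep_var_lebesgue_integral[OF ind ig ih] m0
      by auto
    have "\<epsilon>\<^sup>2 * prob (A j) = expectation (\<lambda>\<omega>. \<epsilon>\<^sup>2 * indicator (A j) \<omega> + 2 * c \<omega>)"
      using c by (subst Bochner_Integration.integral_add) (auto simp: less_top[symmetric])
    also have "\<dots> \<le> expectation (\<lambda>\<omega>. indicator (A j) \<omega> * (S n \<omega>)\<^sup>2)"
    proof (rule integral_mono)
      show "integrable M (\<lambda>\<omega>. \<epsilon>\<^sup>2 * indicator (A j) \<omega> + 2 * c \<omega>)" using c by (auto simp: less_top[symmetric] intro!: Bochner_Integration.integrable_add)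
      show "integrable M (\<lambda>\<omega>. indicator (A j) \<omega> * (S n \<omega>)\<^sup>2)"
        using integrable_mult_indicator[OF A_sets int_S, of j n] by simp
      fix \<omega> assume w: "\<omega> \<in> space M"
      show "\<epsilon>\<^sup>2 * indicator (A j) \<omega> + 2 * c \<omega> \<le> indicator (A j) \<omega> * (S n \<omega>)\<^sup>2"
      proof (cases "\<omega> \<in> A j")
        case True
        then have "\<epsilon> \<le> \<bar>S j \<omega>\<bar>" by (simp add: A_def T_def)
        then have "\<epsilon>\<^sup>2 \<le> (S j \<omega>)\<^sup>2" using \<open>\<epsilon> > 0\<close> by (metis abs_le_square_iff abs_of_pos)
        moreover have "(S n \<omega>)\<^sup>2 = (S j \<omega>)\<^sup>2 + 2 * (S j \<omega> * (S n \<omega> - S j \<omega>)) + (S n \<omega> - S j \<omega>)\<^sup>2"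
          by (simp add: power2_eq_square algebra_simps)
        moreover have "0 \<le> (S n \<omega> - S j \<omega>)\<^sup>2" by simp
        ultimately have "\<epsilon>\<^sup>2 + 2 * (S j \<omega> * (S n \<omega> - S j \<omega>)) \<le> (S n \<omega>)\<^sup>2" by linarith
        then show ?thesis
          using True w by (simp add: c_def g_eq h_eq)
      next
        case False
        then show ?thesis using w by (simp add: c_def g_eq)
      qed
    qed
    finally show ?thesis .
  qed
  have ev: "{\<omega> \<in> space M. \<exists>j\<le>n. \<epsilon> \<le> \<bar>weighted_sum a (I j) \<omega>\<bar>} = (\<Union>j\<le>n. A j)"
  proof (intro set_eqI iffI)
    fix \<omega> assume "\<omega> \<in> {\<omega> \<in> space M. \<exists>j\<le>n. \<epsilon> \<le> \<bar>weighted_sum a (I j) \<omega>\<bar>}"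
    then obtain j where j: "\<omega> \<in> space M" "j \<le> n" "\<epsilon> \<le> \<bar>S j \<omega>\<bar>" by (auto simp: S_def)
    \<comment> \<open>The least index of passage places \<omega> in exactly one of the disjoint
      events \<open>A l\<close>.\<close>
    define l where "l = (LEAST j. \<epsilon> \<le> \<bar>S j \<omega>\<bar>)"
    have "\<epsilon> \<le> \<bar>S l \<omega>\<bar>" "l \<le> j" "\<And>i. i < l \<Longrightarrow> \<not> \<epsilon> \<le> \<bar>S i \<omega>\<bar>"
      unfolding l_def using j by (auto intro: LeastI Least_le dest: not_less_Least)
    then show "\<omega> \<in> (\<Union>j\<le>n. A j)" using j by (auto simp: A_def T_def not_le intro!: bexI[of _ l])
  qed (auto simp: A_def T_def S_def)
  have "\<epsilon>\<^sup>2 * prob (\<Union>j\<le>n. A j) = (\<Sum>j\<le>n. \<epsilon>\<^sup>2 * prob (A j))"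
  proof -
    have "prob (\<Union>j\<le>n. A j) = (\<Sum>j\<le>n. prob (A j))"
      by (rule finite_measure_finite_Union) (use disj in \<open>auto simp: disjoint_family_on_def\<close>)
    then show ?thesis by (simp add: sum_distrib_left)
  qed
  also have "\<dots> \<le> (\<Sum>j\<le>n. expectation (\<lambda>\<omega>. indicator (A j) \<omega> * (S n \<omega>)\<^sup>2))"
    by (intro sum_mono step) auto
  also have "\<dots> = expectation (\<lambda>\<omega>. \<Sum>j\<le>n. indicator (A j) \<omega> * (S n \<omega>)\<^sup>2)"
    using integrable_mult_indicator[OF A_sets int_S]
    by (subst Bochner_Integration.integral_sum) auto
  also have "\<dots> \<le> expectation (\<lambda>\<omega>. (S n \<omega>)\<^sup>2)"
  proof (rule integral_mono)
    show "integrable M (\<lambda>\<omega>. \<Sum>j\<le>n. indicator (A j) \<omega> * (S n \<omega>)\<^sup>2)"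
      using integrable_mult_indicator[OF A_sets int_S] by (intro Bochner_Integration.integrable_sum) auto
    fix \<omega>
    have "(\<Sum>j\<le>n. indicator (A j) \<omega> :: real) = indicator (\<Union>j\<le>n. A j) \<omega>"
      using disj by (intro indicator_UN_disjoint[symmetric]) (auto simp: disjoint_family_on_def)
    then show "(\<Sum>j\<le>n. indicator (A j) \<omega> * (S n \<omega>)\<^sup>2) \<le> (S n \<omega>)\<^sup>2"
      by (simp add: sum_distrib_right[symmetric] mult_left_le_one_le)
  qed (rule int_S)
  also have "\<dots> = (\<Sum>k\<in>I n. (a k)\<^sup>2)"
    unfolding S_def by (rule expectation_weighted_sum_square[OF I(2)])
  finally show ?thesis
    unfolding ev using \<open>\<epsilon> > 0\<close> by (simp add: pos_le_divide_eq mult.commute)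
qed

end

section \<open>Almost sure and mean-square convergence of random series along exhausting index
  sets\<close>

context orthonormal_noise
begin

text \<open>The limit is taken for every \<omega>; where the partial sums diverge,
  \<open>lim\<close> returns one fixed unspecified value, so that the function is measurable
  whatever the coefficients are.\<close>

definition noise_series :: "(nat \<Rightarrow> nat set) \<Rightarrow> (nat \<Rightarrow> real) \<Rightarrow> 'w \<Rightarrow> real" where
  "noise_series I a \<omega> = lim (\<lambda>n. weighted_sum a (I n) \<omega>)"

lemma noise_series_measurable [measurable]: "noise_series I a \<in> borel_measurable M"
  unfolding noise_series_def by measurable

context
  fixes I :: "nat \<Rightarrow> nat set"
  assumes I: "incseq I" "\<And>n. finite (I n)" "(\<Union>n. I n) = UNIV"
begin

text \<open>Apply the maximal inequality to the blocks \<open>I (m + j) - I m\<close>, whose squared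
  coefficients sum to at most the tail beyond \<open>I m\<close>. The bound does not depend on the
  number of blocks, so continuity from below removes the restriction to finitely many
  \<open>j\<close>.\<close>

lemma weighted_sum_tail_bound:
  assumes "summable (\<lambda>k. (a k)\<^sup>2)" "\<epsilon> > 0"
  shows "prob {\<omega> \<in> space M. \<exists>j. \<epsilon> \<le> \<bar>weighted_sum a (I (m + j)) \<omega> - weighted_sum a (I m) \<omega>\<bar>}
    \<le> ((\<Sum>k. (a k)\<^sup>2) - (\<Sum>k\<in>I m. (a k)\<^sup>2)) / \<epsilon>\<^sup>2"
proof -
  define J where "J j = I (m + j) - I m" for j
  have J: "incseq J" "finite (J j)" for j
  proof -
    have "I (m + j) \<subseteq> I (m + Suc j)" for j using I(1) by (rule incseqD) simp
    then show "incseq J" unfolding J_def by (intro incseq_SucI) blast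
  qed (simp add: J_def I(2))
  define E where "E n = {\<omega> \<in> space M. \<exists>j\<le>n. \<epsilon> \<le> \<bar>weighted_sum a (J j) \<omega>\<bar>}" for n
  have [measurable]: "E n \<in> sets M" for n unfolding E_def by measurable
  have eq: "{\<omega> \<in> space M. \<exists>j. \<epsilon> \<le> \<bar>weighted_sum a (I (m + j)) \<omega> - weighted_sum a (I m) \<omega>\<bar>} = (\<Union>n. E n)"
    using weighted_sum_diff[OF I(2) incseqD[OF I(1)], of m "m + _" a] by (auto simp: E_def J_def)
  have lim: "(\<lambda>n. prob (E n)) \<longlonglongrightarrow> prob (\<Union>n. E n)"
    by (rule finite_Lim_measure_incseq) (auto simp: incseq_def E_def intro: order_trans)
  have "prob (E n) \<le> ((\<Sum>k. (a k)\<^sup>2) - (\<Sum>k\<in>I m. (a k)\<^sup>2)) / \<epsilon>\<^sup>2" for n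
  proof -
    have "(\<Sum>k\<in>J n. (a k)\<^sup>2) + (\<Sum>k\<in>I m. (a k)\<^sup>2) = (\<Sum>k\<in>I (m + n). (a k)\<^sup>2)"
      unfolding J_def using I incseqD[OF I(1), of m "m + n"] by (simp add: sum_diff)
    moreover have "\<dots> \<le> (\<Sum>k. (a k)\<^sup>2)"
      using assms(1) I(2) by (intro sum_le_suminf) auto
    ultimately have "(\<Sum>k\<in>J n. (a k)\<^sup>2) / \<epsilon>\<^sup>2 \<le> ((\<Sum>k. (a k)\<^sup>2) - (\<Sum>k\<in>I m. (a k)\<^sup>2)) / \<epsilon>\<^sup>2"
      by (intro divide_right_mono) auto
    then show ?thesis
      using Kolmogorov_maximal_inequality[OF J assms(2), of n a] unfolding E_def by linarith
  qed
  then show ?thesis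
    unfolding eq by (intro LIMSEQ_le_const2[OF lim]) auto
qed

lemma tail_tendsto_0:
  assumes "summable (\<lambda>k. (a k)\<^sup>2)"
  shows "(\<lambda>m. (\<Sum>k. (a k)\<^sup>2) - (\<Sum>k\<in>I m. (a k :: real)\<^sup>2)) \<longlonglongrightarrow> 0"
  using tendsto_diff[OF tendsto_const[of "\<Sum>k. (a k)\<^sup>2"] tendsto_sum_exhaustion[OF _ I, of "\<lambda>k. (a k)\<^sup>2"]] assms
  by simp

text \<open>The tail bound makes the probability of an oscillation of size \<epsilon> after
  \<open>m\<close> tend to 0 as \<open>m\<close> grows, so almost surely some \<open>m\<close> has
  none. Taking \<epsilon> along the countable sequence \<open>1 / (p + 1)\<close> gives the Cauchy
  property.\<close>

lemma AE_convergent_weighted_sum: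
  assumes "summable (\<lambda>k. (a k)\<^sup>2)"
  shows "AE \<omega> in M. convergent (\<lambda>n. weighted_sum a (I n) \<omega>)"
proof -
  define S where "S n \<omega> = weighted_sum a (I n) \<omega>" for n \<omega>
  have [measurable]: "S n \<in> borel_measurable M" for n unfolding S_def by measurable
  have "AE \<omega> in M. \<exists>m. \<forall>j. \<bar>S (m + j) \<omega> - S m \<omega>\<bar> < inverse (real (Suc p))" for p
  proof -
    define \<epsilon> where "\<epsilon> = inverse (real (Suc p))"
    have "\<epsilon> > 0" by (simp add: \<epsilon>_def)
    define B where "B m = {\<omega> \<in> space M. \<exists>j. \<epsilon> \<le> \<bar>S (m + j) \<omega> - S m \<omega>\<bar>}" for m
    have [measurable]: "B m \<in> sets M" for m unfolding B_def by measurable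
    \<comment> \<open>The event that every \<open>m\<close> is followed by a large oscillation lies
      in each \<open>B m\<close>, and the bounds for the \<open>B m\<close> tend to 0.\<close>
    have "prob (\<Inter>m. B m) \<le> ((\<Sum>k. (a k)\<^sup>2) - (\<Sum>k\<in>I m. (a k)\<^sup>2)) / \<epsilon>\<^sup>2" for m
    proof -
      have "prob (\<Inter>m. B m) \<le> prob (B m)" by (rule finite_measure_mono) auto
      also have "\<dots> \<le> ((\<Sum>k. (a k)\<^sup>2) - (\<Sum>k\<in>I m. (a k)\<^sup>2)) / \<epsilon>\<^sup>2"
        unfolding B_def S_def by (rule weighted_sum_tail_bound[OF assms \<open>\<epsilon> > 0\<close>])
      finally show ?thesis .
    qed
    moreover have "(\<lambda>m. ((\<Sum>k. (a k)\<^sup>2) - (\<Sum>k\<in>I m. (a k)\<^sup>2)) / \<epsilon>\<^sup>2) \<longlonglongrightarrow> 0"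
      using tendsto_divide[OF tail_tendsto_0[OF assms] tendsto_const, of "\<epsilon>\<^sup>2"] \<open>\<epsilon> > 0\<close> by simp
    ultimately have "prob (\<Inter>m. B m) \<le> 0"
      by (intro LIMSEQ_le_const) auto
    then have "prob (\<Inter>m. B m) = 0" by (simp add: measure_le_0_iff)
    then have "(\<Inter>m. B m) \<in> null_sets M"
      by (simp add: null_sets_def emeasure_eq_measure)
    then have "AE \<omega> in M. \<omega> \<notin> (\<Inter>m. B m)" by (rule AE_not_in)
    then show ?thesis
      by (rule AE_mp) (auto simp: B_def \<epsilon>_def not_le intro!: AE_I2)
  qed
  then have "AE \<omega> in M. \<forall>p. \<exists>m. \<forall>j. \<bar>S (m + j) \<omega> - S m \<omega>\<bar> < inverse (real (Suc p))"
    by (simp add: AE_all_countable)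
  then show ?thesis
  proof eventually_elim
    case (elim \<omega>)
    have "Cauchy (\<lambda>n. S n \<omega>)"
      unfolding Cauchy_def
    proof (intro allI impI)
      fix e :: real assume "e > 0"
      then obtain p where p: "inverse (real (Suc p)) < e / 2" using reals_Archimedean[of "e / 2"] by auto
      obtain m where m: "\<And>j. \<bar>S (m + j) \<omega> - S m \<omega>\<bar> < inverse (real (Suc p))" using elim by blast
      have "dist (S i \<omega>) (S j \<omega>) < e" if "i \<ge> m" "j \<ge> m" for i j
        using m[of "i - m"] m[of "j - m"] that p by (simp add: dist_real_def)
      then show "\<exists>m. \<forall>i\<ge>m. \<forall>j\<ge>m. dist (S i \<omega>) (S j \<omega>) < e" by blast
    qed
    then show ?case unfolding S_def by (rule Cauchy_convergent)
  qed
qed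

text \<open>Almost surely \<open>S m - S n\<close> tends to \<open>S m - L\<close> as
  \<open>n\<close> grows, so Fatou's lemma bounds the second moment of the latter by that of
  \<open>S m - S n\<close>, which orthogonality computes as a sum of squares over
  \<open>I n - I m\<close>.\<close>

lemma noise_series_L2:
  assumes "summable (\<lambda>k. (a k)\<^sup>2)"
  shows "integrable M (\<lambda>\<omega>. (weighted_sum a (I m) \<omega> - noise_series I a \<omega>)\<^sup>2)"
    and "expectation (\<lambda>\<omega>. (weighted_sum a (I m) \<omega> - noise_series I a \<omega>)\<^sup>2)
      \<le> (\<Sum>k. (a k)\<^sup>2) - (\<Sum>k\<in>I m. (a k)\<^sup>2)"
proof -
  define S where "S n \<omega> = weighted_sum a (I n) \<omega>" for n \<omega>
  define L where "L = noise_series I a"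
  define R where "R = (\<Sum>k. (a k)\<^sup>2) - (\<Sum>k\<in>I m. (a k)\<^sup>2)"
  have [measurable]: "S n \<in> borel_measurable M" for n unfolding S_def by measurable
  have [measurable]: "L \<in> borel_measurable M" unfolding L_def by measurable
  \<comment> \<open>Nonnegativity is needed to return from \<open>ennreal R\<close> to
    \<open>R\<close>, since \<open>ennreal\<close> sends negative numbers to 0.\<close>
  have R0: "R \<ge> 0" unfolding R_def using sum_le_suminf[OF assms I(2)] by simp
  have conv: "AE \<omega> in M. ennreal ((S m \<omega> - L \<omega>)\<^sup>2) = liminf (\<lambda>n. ennreal ((S m \<omega> - S n \<omega>)\<^sup>2))"
    using AE_convergent_weighted_sum[OF assms]
  proof eventually_elim
    case (elim \<omega>)
    then have "(\<lambda>n. S n \<omega>) \<longlonglongrightarrow> L \<omega>"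
      unfolding S_def L_def noise_series_def by (simp add: convergent_LIMSEQ_iff)
    then have "(\<lambda>n. ennreal ((S m \<omega> - S n \<omega>)\<^sup>2)) \<longlonglongrightarrow> ennreal ((S m \<omega> - L \<omega>)\<^sup>2)"
      by (intro tendsto_intros)
    from lim_imp_Liminf[OF sequentially_bot this] show ?case ..
  qed
  have "(\<integral>\<^sup>+\<omega>. ennreal ((S m \<omega> - L \<omega>)\<^sup>2) \<partial>M) = (\<integral>\<^sup>+\<omega>. liminf (\<lambda>n. ennreal ((S m \<omega> - S n \<omega>)\<^sup>2)) \<partial>M)"
    using conv by (rule nn_integral_cong_AE)
  also have "\<dots> \<le> liminf (\<lambda>n. \<integral>\<^sup>+\<omega>. ennreal ((S m \<omega> - S n \<omega>)\<^sup>2) \<partial>M)"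
    by (rule nn_integral_liminf) measurable
  also have "\<dots> \<le> liminf (\<lambda>n. ennreal R)"
  proof (rule Liminf_mono)
    show "\<forall>\<^sub>F n in sequentially. (\<integral>\<^sup>+\<omega>. ennreal ((S m \<omega> - S n \<omega>)\<^sup>2) \<partial>M) \<le> ennreal R"
      unfolding eventually_sequentially
    proof (intro exI[of _ m] allI impI)
      fix n assume "m \<le> n"
      with I(1) have sub: "I m \<subseteq> I n" by (rule incseqD)
      have "(S m \<omega> - S n \<omega>)\<^sup>2 = (weighted_sum a (I n - I m) \<omega>)\<^sup>2" for \<omega>
        using weighted_sum_diff[OF I(2) sub, of a \<omega>] by (simp add: S_def power2_commute[of "weighted_sum a (I m) \<omega>"])
      then have "(\<integral>\<^sup>+\<omega>. ennreal ((S m \<omega> - S n \<omega>)\<^sup>2) \<partial>M)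
          = ennreal (expectation (\<lambda>\<omega>. (weighted_sum a (I n - I m) \<omega>)\<^sup>2))"
        by (simp add: nn_integral_eq_integral integrable_weighted_sum_square)
      also have "expectation (\<lambda>\<omega>. (weighted_sum a (I n - I m) \<omega>)\<^sup>2) = (\<Sum>k\<in>I n - I m. (a k)\<^sup>2)"
        using I by (simp add: expectation_weighted_sum_square)
      also have "\<dots> \<le> R"
        unfolding R_def using sum_le_suminf[OF assms I(2), of n] I(2) sub by (simp add: sum_diff)
      finally show "(\<integral>\<^sup>+\<omega>. ennreal ((S m \<omega> - S n \<omega>)\<^sup>2) \<partial>M) \<le> ennreal R"
        using ennreal_leI by auto
    qed
  qed
  finally have le: "(\<integral>\<^sup>+\<omega>. ennreal ((S m \<omega> - L \<omega>)\<^sup>2) \<partial>M) \<le> ennreal R"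
    by (simp add: Liminf_const)
  show int: "integrable M (\<lambda>\<omega>. (weighted_sum a (I m) \<omega> - noise_series I a \<omega>)\<^sup>2)"
    using le by (intro integrableI_nonneg) (auto simp: S_def L_def top_unique less_top[symmetric])
  show "expectation (\<lambda>\<omega>. (weighted_sum a (I m) \<omega> - noise_series I a \<omega>)\<^sup>2) \<le> R"
    using le R0 int by (simp add: S_def L_def nn_integral_eq_integral)
qed

lemma noise_series_L2_tendsto:
  assumes "summable (\<lambda>k. (a k)\<^sup>2)"
  shows "(\<lambda>n. expectation (\<lambda>\<omega>. (weighted_sum a (I n) \<omega> - noise_series I a \<omega>)\<^sup>2)) \<longlonglongrightarrow> 0"
  by (rule tendsto_sandwich[OF _ _ tendsto_const tail_tendsto_0[OF assms]])
     (auto intro!: always_eventually noise_series_L2(2)[OF assms])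

lemma noise_series_square_integrable:
  assumes "summable (\<lambda>k. (a k)\<^sup>2)"
  shows "integrable M (\<lambda>\<omega>. (noise_series I a \<omega>)\<^sup>2)"
  using integrable_add_square[of "\<lambda>\<omega>. noise_series I a \<omega> - weighted_sum a (I 0) \<omega>" M "weighted_sum a (I 0)"]
    noise_series_L2(1)[OF assms, of 0]
  by (simp add: integrable_weighted_sum_square power2_commute[of "noise_series I a _"])

lemma expectation_noise_series:
  assumes "summable (\<lambda>k. (a k)\<^sup>2)"
  shows "expectation (noise_series I a) = 0"
proof -
  \<comment> \<open>The mean is read as the inner product with the constant 1, so that the
    convergence of products in mean square applies.\<close>
  have "(\<lambda>n. expectation (\<lambda>\<omega>. weighted_sum a (I n) \<omega> * 1)) \<longlonglongrightarrow> expectation (\<lambda>\<omega>. noise_series I a \<omega> * 1)"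
    by (rule tendsto_integral_mult_L2)
       (auto simp: noise_series_square_integrable[OF assms] integrable_weighted_sum_square
          noise_series_L2_tendsto[OF assms])
  then show ?thesis by (simp add: expectation_weighted_sum LIMSEQ_const_iff)
qed

text \<open>Orthogonality gives the finite sum over \<open>I n\<close> for the partial sums. Its
  limit is the full series because \<open>a k * b k\<close> is absolutely summable, being dominated
  by the sum of the squares; the left side converges by mean-square continuity of products.\<close>

lemma expectation_noise_series_mult:
  assumes a: "summable (\<lambda>k. (a k)\<^sup>2)" and b: "summable (\<lambda>k. (b k)\<^sup>2)"
  shows "expectation (\<lambda>\<omega>. noise_series I a \<omega> * noise_series I b \<omega>) = (\<Sum>k. a k * b k)"
proof -
  have "summable (\<lambda>k. \<bar>a k * b k\<bar>)"
  proof (rule summable_comparison_test')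
    show "summable (\<lambda>k. (a k)\<^sup>2 + (b k)\<^sup>2)" using a b by (rule summable_add)
    show "norm \<bar>a k * b k\<bar> \<le> (a k)\<^sup>2 + (b k)\<^sup>2" if "k \<ge> 0" for k
      using abs_mult_le_sum_squares by simp
  qed
  then have "(\<lambda>n. \<Sum>k\<in>I n. a k * b k) \<longlonglongrightarrow> (\<Sum>k. a k * b k)"
    by (rule tendsto_sum_exhaustion[OF _ I])
  moreover have "(\<lambda>n. expectation (\<lambda>\<omega>. weighted_sum a (I n) \<omega> * weighted_sum b (I n) \<omega>))
      \<longlonglongrightarrow> expectation (\<lambda>\<omega>. noise_series I a \<omega> * noise_series I b \<omega>)"
    by (rule tendsto_integral_mult_L2)
       (auto simp: noise_series_square_integrable a b integrable_weighted_sum_square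
          noise_series_L2_tendsto)
  ultimately show ?thesis
    by (simp add: expectation_weighted_sum_mult I(2) LIMSEQ_unique)
qed

end

end

section \<open>Independence and product laws\<close>

text \<open>Independence is available as independence of families of events. Preimages of rectangles
  factorise, and measurable rectangles determine the product measure; this turns the hypothesis into
  a form to which Fubini applies.\<close>

lemma (in prob_space) distr_pair_indep_set:
  assumes indep: "indep_set F H"
    and X: "X \<in> measurable M S" "\<And>C. C \<in> sets S \<Longrightarrow> X -` C \<inter> space M \<in> F"
    and Y: "Y \<in> measurable M T" "\<And>C. C \<in> sets T \<Longrightarrow> Y -` C \<inter> space M \<in> H"
  shows "distr M S X \<Otimes>\<^sub>M distr M T Y = distr M (S \<Otimes>\<^sub>M T) (\<lambda>\<omega>. (X \<omega>, Y \<omega>))"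
proof (rule pair_measure_eqI)
  interpret X: prob_space "distr M S X" by (rule prob_space_distr) fact
  interpret Y: prob_space "distr M T Y" by (rule prob_space_distr) fact
  show "sigma_finite_measure (distr M S X)" "sigma_finite_measure (distr M T Y)" ..
  fix A B assume "A \<in> sets (distr M S X)" and "B \<in> sets (distr M T Y)"
  then have A: "A \<in> sets S" and B: "B \<in> sets T" by auto
  have "(\<lambda>\<omega>. (X \<omega>, Y \<omega>)) -` (A \<times> B) \<inter> space M = (X -` A \<inter> space M) \<inter> (Y -` B \<inter> space M)"
    by auto
  then have "emeasure (distr M (S \<Otimes>\<^sub>M T) (\<lambda>\<omega>. (X \<omega>, Y \<omega>))) (A \<times> B)
      = ennreal (prob ((X -` A \<inter> space M) \<inter> (Y -` B \<inter> space M)))"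
    using A B X(1) Y(1) by (simp add: emeasure_distr emeasure_eq_measure)
  also have "\<dots> = ennreal (prob (X -` A \<inter> space M) * prob (Y -` B \<inter> space M))"
    using indep_setD[OF indep X(2)[OF A] Y(2)[OF B]] by simp
  finally show "emeasure (distr M S X) A * emeasure (distr M T Y) B
      = emeasure (distr M (S \<Otimes>\<^sub>M T) (\<lambda>\<omega>. (X \<omega>, Y \<omega>))) (A \<times> B)"
    using A B X(1) Y(1) by (simp add: emeasure_distr emeasure_eq_measure ennreal_mult)
qed simp

text \<open>This plays the role of conditioning on \<open>X\<close>: integrals of functions of
  \<open>(X, Y)\<close> become iterated integrals over two copies of the same probability space, one
  carrying \<open>X\<close> and the other \<open>Y\<close>.\<close>

locale product_law = prob_space M for M :: "'w measure" +
  fixes S :: "'a measure" and T :: "'b measure" and X Y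
  assumes X: "X \<in> measurable M S" and Y: "Y \<in> measurable M T"
    and law: "distr M S X \<Otimes>\<^sub>M distr M T Y = distr M (S \<Otimes>\<^sub>M T) (\<lambda>\<omega>. (X \<omega>, Y \<omega>))"
begin

sublocale pX: prob_space "distr M S X" by (rule prob_space_distr[OF X])
sublocale pY: prob_space "distr M T Y" by (rule prob_space_distr[OF Y])
sublocale pXY: pair_prob_space "distr M S X" "distr M T Y" ..

lemma nn_integral_product:
  assumes h [measurable]: "h \<in> borel_measurable (S \<Otimes>\<^sub>M T)"
  shows "(\<integral>\<^sup>+\<omega>. h (X \<omega>, Y \<omega>) \<partial>M) = (\<integral>\<^sup>+\<omega>. \<integral>\<^sup>+\<omega>'. h (X \<omega>, Y \<omega>') \<partial>M \<partial>M)"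
proof -
  note [measurable] = X Y
  have "(\<integral>\<^sup>+\<omega>. h (X \<omega>, Y \<omega>) \<partial>M) = (\<integral>\<^sup>+p. h p \<partial>(distr M S X \<Otimes>\<^sub>M distr M T Y))"
    unfolding law by (simp add: nn_integral_distr)
  also have "\<dots> = (\<integral>\<^sup>+x. \<integral>\<^sup>+y. h (x, y) \<partial>distr M T Y \<partial>distr M S X)"
    by (rule pY.nn_integral_fst[symmetric]) simp
  also have "\<dots> = (\<integral>\<^sup>+\<omega>. \<integral>\<^sup>+y. h (X \<omega>, y) \<partial>distr M T Y \<partial>M)"
    by (subst nn_integral_distr) auto
  also have "\<dots> = (\<integral>\<^sup>+\<omega>. \<integral>\<^sup>+\<omega>'. h (X \<omega>, Y \<omega>') \<partial>M \<partial>M)"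
    using measurable_space[OF X] by (intro nn_integral_cong nn_integral_distr) auto
  finally show ?thesis .
qed

text \<open>The exceptional set is measurable in the product, so its probability is an iterated
  integral whose inner integrals vanish almost surely. Without the measurability of \<open>P\<close>
  the almost sure statements on the fibres would not combine.\<close>

lemma AE_product:
  assumes P: "{p \<in> space (S \<Otimes>\<^sub>M T). P (fst p) (snd p)} \<in> sets (S \<Otimes>\<^sub>M T)"
    and ae: "AE \<omega> in M. AE \<omega>' in M. P (X \<omega>) (Y \<omega>')"
  shows "AE \<omega> in M. P (X \<omega>) (Y \<omega>)"
proof -
  note [measurable] = X Y
  define N where "N = space (S \<Otimes>\<^sub>M T) - {p \<in> space (S \<Otimes>\<^sub>M T). P (fst p) (snd p)}"
  have [measurable]: "N \<in> sets (S \<Otimes>\<^sub>M T)" unfolding N_def using P by auto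
  have "(\<integral>\<^sup>+\<omega>. indicator N (X \<omega>, Y \<omega>) \<partial>M) = (\<integral>\<^sup>+\<omega>. \<integral>\<^sup>+\<omega>'. indicator N (X \<omega>, Y \<omega>') \<partial>M \<partial>M)"
    by (rule nn_integral_product) measurable
  also have "\<dots> = (\<integral>\<^sup>+\<omega>. 0 \<partial>M)"
  proof (rule nn_integral_cong_AE, use ae in eventually_elim)
    case (elim \<omega>)
    then have "(\<integral>\<^sup>+\<omega>'. indicator N (X \<omega>, Y \<omega>') \<partial>M) = (\<integral>\<^sup>+\<omega>'. 0 \<partial>M)"
      by (intro nn_integral_cong_AE) (auto simp: N_def indicator_def elim!: AE_mp)
    then show ?case by simp
  qed
  finally have "(\<integral>\<^sup>+\<omega>. indicator N (X \<omega>, Y \<omega>) \<partial>M) = 0" by simp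
  then have "AE \<omega> in M. indicator N (X \<omega>, Y \<omega>) = (0 :: ennreal)"
    by (subst nn_integral_0_iff_AE[symmetric]) auto
  then show ?thesis
    using AE_space
  proof eventually_elim
    case (elim \<omega>)
    then show ?case
      using measurable_space[OF X] measurable_space[OF Y]
      by (auto simp: N_def space_pair_measure split: split_indicator_asm)
  qed
qed

lemma integral_product:
  fixes h :: "'a \<times> 'b \<Rightarrow> real"
  assumes h [measurable]: "h \<in> borel_measurable (S \<Otimes>\<^sub>M T)"
    and int: "integrable M (\<lambda>\<omega>. h (X \<omega>, Y \<omega>))"
  shows "(LINT \<omega>|M. h (X \<omega>, Y \<omega>)) = (LINT \<omega>|M. LINT \<omega>'|M. h (X \<omega>, Y \<omega>'))"
proof -
  note [measurable] = X Y
  have int': "integrable (distr M S X \<Otimes>\<^sub>M distr M T Y) h"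
    unfolding law using int by (simp add: integrable_distr_eq)
  have "(LINT \<omega>|M. h (X \<omega>, Y \<omega>)) = (LINT p|(distr M S X \<Otimes>\<^sub>M distr M T Y). h p)"
    unfolding law by (simp add: integral_distr)
  also have "\<dots> = (LINT x|distr M S X. LINT y|distr M T Y. h (x, y))"
    by (rule pXY.integral_fst'[symmetric, OF int'])
  also have "\<dots> = (LINT \<omega>|M. LINT y|distr M T Y. h (X \<omega>, y))"
    by (subst integral_distr) (auto intro!: pY.borel_measurable_lebesgue_integral)
  also have "\<dots> = (LINT \<omega>|M. LINT \<omega>'|M. h (X \<omega>, Y \<omega>'))"
    using measurable_space[OF X] by (intro Bochner_Integration.integral_cong integral_distr) auto
  finally show ?thesis .
qed

end

section \<open>Measurability with respect to generated sigma-algebras\<close>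

lemma generators_subset_Pow: "{X i -` A \<inter> space M |i A. i \<in> I \<and> A \<in> sets borel} \<subseteq> Pow (space M)"
  by auto

lemma generated_events_subset_Pow: "generated_events M I X \<subseteq> Pow (space M)"
  unfolding generated_events_def using sigma_sets_into_sp[OF generators_subset_Pow] by blast

lemma sets_sigma_generated_events: "sets (sigma (space M) (generated_events M I X)) = generated_events M I X"
  unfolding sets_measure_of[OF generated_events_subset_Pow] unfolding generated_events_def
  by (rule sigma_sets_sigma_sets_eq[OF generators_subset_Pow])

lemma measurable_sigma_generated:
  assumes "generated_events M I X \<subseteq> G" "G \<subseteq> Pow (space M)" "i \<in> I"
  shows "X i \<in> borel_measurable (sigma (space M) G)"
proof (rule measurableI)
  fix A :: "real set" assume "A \<in> sets borel"
  then have "X i -` A \<inter> space M \<in> generated_events M I X"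
    unfolding generated_events_def using assms(3) by (intro sigma_sets.Basic) blast
  then show "X i -` A \<inter> space (sigma (space M) G) \<in> sets (sigma (space M) G)"
    using assms(1,2) by (auto simp: sets_measure_of space_measure_of_conv intro: sigma_sets.Basic)
qed simp

section \<open>Poisson points and the Campbell formula\<close>

text \<open>The factor \<open>n\<close> cancels against the factorial, which shifts the exponential
  series by one index; the term for \<open>n = 0\<close> vanishes.\<close>

lemma poisson_mean: "(\<Sum>n. ennreal (real n * (r ^ n / fact n * exp (- r)))) = ennreal r" if "r \<ge> 0"
proof -
  have "(\<lambda>n. r * (r ^ n / fact n * exp (- r))) sums (r * (exp r * exp (- r)))"
    using exp_converges[of r] by (intro sums_mult sums_mult2) (simp add: divide_inverse mult.commute)
  moreover have "(\<lambda>n. r * (r ^ n / fact n * exp (- r)))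
      = (\<lambda>n. real (Suc n) * (r ^ Suc n / fact (Suc n) * exp (- r)))"
    by (simp add: fun_eq_iff field_simps del: of_nat_Suc)
  ultimately have "(\<lambda>n. real (Suc n) * (r ^ Suc n / fact (Suc n) * exp (- r))) sums r"
    by (simp add: exp_minus)
  then have "(\<lambda>n. real n * (r ^ n / fact n * exp (- r))) sums r"
    using sums_Suc[of "\<lambda>n. real n * (r ^ n / fact n * exp (- r))" r] by simp
  then show ?thesis
    using that by (intro suminf_ennreal_eq) auto
qed

lemma enumerates_measurable: "enumerates M X \<xi> \<Longrightarrow> \<xi> k \<in> borel_measurable M"
  by (auto simp: enumerates_def)

lemma enumerates_bij:
  "enumerates M X \<xi> \<Longrightarrow> \<omega> \<in> space M \<Longrightarrow> infinite (X \<omega>) \<Longrightarrow> bij_betw (\<lambda>k. \<xi> k \<omega>) UNIV (X \<omega>)"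
  by (auto simp: enumerates_def)

lemma enumerates_window_bij:
  assumes "enumerates M X \<xi>" "\<omega> \<in> space M"
  shows "bij_betw (\<lambda>k. \<xi> k \<omega>) {k. (finite (X \<omega>) \<longrightarrow> k < card (X \<omega>)) \<and> \<bar>\<xi> k \<omega>\<bar> \<le> real n}
    (X \<omega> \<inter> {- real n..real n})" (is "bij_betw _ ?K _")
proof (rule bij_betw_imageI)
  define K where "K = {k. finite (X \<omega>) \<longrightarrow> k < card (X \<omega>)}"
  have bij: "bij_betw (\<lambda>k. \<xi> k \<omega>) K (X \<omega>)"
    using assms unfolding enumerates_def K_def by blast
  show "inj_on (\<lambda>k. \<xi> k \<omega>) ?K"
    using bij_betw_imp_inj_on[OF bij] by (rule inj_on_subset) (auto simp: K_def)
  have "x \<in> {- real n..real n} \<longleftrightarrow> \<bar>x\<bar> \<le> real n" for x by auto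
  then have K: "?K = {k \<in> K. \<xi> k \<omega> \<in> {- real n..real n}}" by (simp only: K_def mem_Collect_eq)
  have "(\<lambda>k. \<xi> k \<omega>) ` {k \<in> K. \<xi> k \<omega> \<in> B} = (\<lambda>k. \<xi> k \<omega>) ` K \<inter> B" for B by blast
  then show "(\<lambda>k. \<xi> k \<omega>) ` ?K = X \<omega> \<inter> {- real n..real n}"
    by (simp only: K bij_betw_imp_surj_on[OF bij])
qed

section \<open>Counts of a Poisson process in bounded sets\<close>

locale poisson_points = prob_space M for M :: "'w measure" +
  fixes r :: real and X :: "'w \<Rightarrow> real set"
  assumes poisson: "poisson_process M r X" and intensity: "r > 0"
begin

lemma finite_window: "\<omega> \<in> space M \<Longrightarrow> bounded A \<Longrightarrow> finite (X \<omega> \<inter> A)"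
  using poisson by (auto simp: poisson_process_def)

lemma count_measurable:
  "A \<in> sets borel \<Longrightarrow> bounded A \<Longrightarrow> (\<lambda>\<omega>. card (X \<omega> \<inter> A)) \<in> measurable M (count_space UNIV)"
  using poisson by (auto simp: poisson_process_def)

lemma prob_count: "A \<in> sets borel \<Longrightarrow> bounded A \<Longrightarrow>
    prob {\<omega> \<in> space M. card (X \<omega> \<inter> A) = n}
      = (r * measure lborel A) ^ n / fact n * exp (- (r * measure lborel A))"
  using poisson by (auto simp: poisson_process_def)

text \<open>A finite configuration has the constant count \<open>m = card (X \<omega>)\<close> in
  all large windows, while for fixed \<open>m\<close> the probability of exactly \<open>m\<close>
  points in \<open>[-n, n]\<close> tends to 0. Consequently an enumeration almost surely uses every
  index, and no bound on \<open>k\<close> has to be carried along.\<close>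

lemma AE_infinite: "AE \<omega> in M. infinite (X \<omega>)"
proof -
  define N where "N m n = {\<omega> \<in> space M. card (X \<omega> \<inter> {- real n..real n}) = m}" for m n
  have [measurable]: "N m n \<in> sets M" for m n
    unfolding N_def using count_measurable[of "{- real n..real n}"] by measurable
  have lim: "(\<lambda>n. prob (N m n)) \<longlonglongrightarrow> 0" for m
  proof -
    have "filterlim (\<lambda>n. r * (2 * real n)) at_top sequentially"
      using intensity by real_asymp
    then have "(\<lambda>n. (r * (2 * real n)) ^ m / exp (r * (2 * real n))) \<longlonglongrightarrow> 0"
      by (rule filterlim_compose[OF tendsto_power_div_exp_0])
    then have "(\<lambda>n. (r * (2 * real n)) ^ m / exp (r * (2 * real n)) / fact m) \<longlonglongrightarrow> 0 / fact m"
      by (intro tendsto_divide) auto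
    then show ?thesis
      unfolding N_def by (subst prob_count) (simp_all add: exp_minus field_simps)
  qed
  \<comment> \<open>Having count \<open>m\<close> in all windows from \<open>j\<close> on is
    contained in each \<open>N m n\<close> with \<open>n \<ge> j\<close>, hence null.\<close>
  have "AE \<omega> in M. \<exists>n\<ge>j. \<omega> \<notin> N m n" for m j
  proof -
    have "prob (\<Inter>n\<in>{j..}. N m n) \<le> 0"
    proof (rule LIMSEQ_le_const[OF lim[of m]], intro exI allI impI)
      fix n assume "j \<le> n"
      then show "prob (\<Inter>n\<in>{j..}. N m n) \<le> prob (N m n)"
        by (intro finite_measure_mono) auto
    qed
    then have "(\<Inter>n\<in>{j..}. N m n) \<in> null_sets M"
      by (intro null_setsI) (auto simp: emeasure_eq_measure measure_le_0_iff)
    then show ?thesis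
      by (rule AE_mp[OF AE_not_in]) auto
  qed
  then have "AE \<omega> in M. \<forall>m j. \<exists>n\<ge>j. \<omega> \<notin> N m n"
    by (simp add: AE_all_countable)
  with AE_space show ?thesis
  proof eventually_elim
    case (elim \<omega>)
    show ?case
    proof
      assume fin: "finite (X \<omega>)"
      then obtain b where b: "\<And>x. x \<in> X \<omega> \<Longrightarrow> \<bar>x\<bar> \<le> b"
        using finite_imp_bounded[OF fin] by (auto simp: bounded_iff)
      obtain j where j: "b \<le> real j" using real_arch_simple by blast
      have "\<omega> \<in> N (card (X \<omega>)) n" if "n \<ge> j" for n
      proof -
        have "- real n \<le> x \<and> x \<le> real n" if "x \<in> X \<omega>" for x
          using b[OF that] j \<open>n \<ge> j\<close> by linarith
        then have "X \<omega> \<inter> {- real n..real n} = X \<omega>" by auto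
        then show ?thesis using elim by (simp add: N_def)
      qed
      then show False using elim by blast
    qed
  qed
qed

text \<open>The whole process need not be finite, so its cardinality is only measurable through bounded windows.\<close>

lemma many_points_iff:
  assumes "\<omega> \<in> space M"
  shows "(finite (X \<omega>) \<longrightarrow> k < card (X \<omega>)) \<longleftrightarrow> (\<exists>m. k < card (X \<omega> \<inter> {- real m..real m}))"
proof
  assume many: "finite (X \<omega>) \<longrightarrow> k < card (X \<omega>)"
  \<comment> \<open>It suffices to catch \<open>k + 1\<close> points in one window; a finite set of
    that size exists whether or not the configuration is finite.\<close>
  obtain T where T: "T \<subseteq> X \<omega>" "finite T" "card T = Suc k"
  proof (cases "finite (X \<omega>)")
    case True
    then have "Suc k \<le> card (X \<omega>)" using many by simp
    then show ?thesis using that by (rule obtain_subset_with_card_n)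
  next
    case False
    then show ?thesis using that infinite_arbitrarily_large[of "X \<omega>" "Suc k"] by blast
  qed
  obtain b where b: "\<And>x. x \<in> T \<Longrightarrow> \<bar>x\<bar> \<le> b"
    using finite_imp_bounded[OF T(2)] by (auto simp: bounded_iff)
  obtain m where m: "b \<le> real m" using real_arch_simple by blast
  have "- real m \<le> x \<and> x \<le> real m" if "x \<in> T" for x
    using b[OF that] m by linarith
  then have "T \<subseteq> X \<omega> \<inter> {- real m..real m}" using T(1) by auto
  then have "Suc k \<le> card (X \<omega> \<inter> {- real m..real m})"
    unfolding T(3)[symmetric] by (intro card_mono finite_window assms) auto
  then show "\<exists>m. k < card (X \<omega> \<inter> {- real m..real m})" by (auto simp: Suc_le_eq)
next
  assume "\<exists>m. k < card (X \<omega> \<inter> {- real m..real m})"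
  then obtain m where m: "k < card (X \<omega> \<inter> {- real m..real m})" ..
  show "finite (X \<omega>) \<longrightarrow> k < card (X \<omega>)"
  proof
    assume "finite (X \<omega>)"
    then have "card (X \<omega> \<inter> {- real m..real m}) \<le> card (X \<omega>)" by (intro card_mono) auto
    with m show "k < card (X \<omega>)" by simp
  qed
qed

text \<open>A sum over a random set becomes a series over all indices whose terms are switched on by
  measurable conditions. The identity is proved for every sample, including finite configurations,
  so admissible indices are described through window counts.\<close>

lemma window_sum_measurable:
  assumes enum: "enumerates M X \<xi>"
    and marks: "\<And>k. (\<lambda>\<omega>. eps (\<xi> k \<omega>) \<omega>) \<in> borel_measurable M"
    and Z [measurable]: "Z u \<in> borel_measurable M" and f [measurable]: "f \<in> borel_measurable borel"
  shows "window_sum X eps f Z n u \<in> borel_measurable M"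
proof -
  define \<eta> where "\<eta> k \<omega> = eps (\<xi> k \<omega>) \<omega>" for k \<omega>
  have [measurable]: "\<eta> k \<in> borel_measurable M" "\<xi> k \<in> borel_measurable M" for k
    using marks enumerates_measurable[OF enum] unfolding \<eta>_def by auto
  have [measurable]: "(\<lambda>\<omega>. card (X \<omega> \<inter> {- real m..real m})) \<in> measurable M (count_space UNIV)" for m
    by (rule count_measurable) auto
  have "window_sum X eps f Z n u \<omega> = (\<Sum>k. if (\<exists>m. k < card (X \<omega> \<inter> {- real m..real m})) \<and> \<bar>\<xi> k \<omega>\<bar> \<le> real n
      then \<eta> k \<omega> * f (Z u \<omega> - \<xi> k \<omega>) else 0)" if w: "\<omega> \<in> space M" for \<omega>
  proof -
    define K where "K = {k. (\<exists>m. k < card (X \<omega> \<inter> {- real m..real m})) \<and> \<bar>\<xi> k \<omega>\<bar> \<le> real n}"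
    have bij: "bij_betw (\<lambda>k. \<xi> k \<omega>) K (X \<omega> \<inter> {- real n..real n})"
      unfolding K_def using enumerates_window_bij[OF enum w, of n] by (simp only: many_points_iff[OF w])
    have K: "finite K" using bij_betw_finite[OF bij] finite_window[OF w] by simp
    have "window_sum X eps f Z n u \<omega> = (\<Sum>k\<in>K. \<eta> k \<omega> * f (Z u \<omega> - \<xi> k \<omega>))"
      unfolding window_sum_def \<eta>_def by (rule sum.reindex_bij_betw[OF bij, symmetric])
    also have "\<dots> = (\<Sum>k\<in>K. if k \<in> K then \<eta> k \<omega> * f (Z u \<omega> - \<xi> k \<omega>) else 0)" by simp
    also have "\<dots> = (\<Sum>k. if k \<in> K then \<eta> k \<omega> * f (Z u \<omega> - \<xi> k \<omega>) else 0)"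
      by (rule suminf_finite[OF K, symmetric]) simp
    finally show ?thesis by (simp only: K_def mem_Collect_eq)
  qed
  then show ?thesis
    by (subst measurable_cong) measurable
qed

text \<open>Decompose by the value of the count; each layer factorises by hypothesis, and the mean
  of the Poisson law remains. The event \<open>F\<close> will be an event of the field.\<close>

lemma expected_count:
  assumes A: "A \<in> sets borel" "bounded A"
    and F: "F \<in> sets M" "\<And>n. prob ({\<omega> \<in> space M. card (X \<omega> \<inter> A) = n} \<inter> F)
        = prob {\<omega> \<in> space M. card (X \<omega> \<inter> A) = n} * prob F"
  shows "(\<integral>\<^sup>+\<omega>. of_nat (card (X \<omega> \<inter> A)) * indicator F \<omega> \<partial>M) = ennreal r * emeasure lborel A * emeasure M F"
proof -
  define N where "N n = {\<omega> \<in> space M. card (X \<omega> \<inter> A) = n}" for n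
  have [measurable]: "N n \<in> sets M" for n
    unfolding N_def using count_measurable[OF A] by measurable
  have "emeasure lborel A < \<infinity>" using A(2) by (rule emeasure_bounded_finite)
  then have lA: "emeasure lborel A = ennreal (measure lborel A)"
    by (intro emeasure_eq_ennreal_measure) auto
  have "(\<integral>\<^sup>+\<omega>. of_nat (card (X \<omega> \<inter> A)) * indicator F \<omega> \<partial>M)
      = (\<integral>\<^sup>+\<omega>. (\<Sum>n. of_nat n * indicator (N n \<inter> F) \<omega>) \<partial>M)"
  proof (rule nn_integral_cong)
    fix \<omega> assume w: "\<omega> \<in> space M"
    define c where "c = card (X \<omega> \<inter> A)"
    have "(\<Sum>n. of_nat n * indicator (N n \<inter> F) \<omega> :: ennreal)
        = (\<Sum>n\<in>{c}. of_nat n * indicator (N n \<inter> F) \<omega>)"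
      by (rule suminf_finite) (auto simp: N_def c_def)
    also have "\<dots> = of_nat c * indicator F \<omega>"
      using w by (simp add: N_def c_def indicator_def)
    finally show "of_nat (card (X \<omega> \<inter> A)) * indicator F \<omega> = (\<Sum>n. of_nat n * indicator (N n \<inter> F) \<omega> :: ennreal)"
      by (simp only: c_def)
  qed
  also have "\<dots> = (\<Sum>n. of_nat n * emeasure M (N n \<inter> F))"
    using F(1) by (subst nn_integral_suminf) (auto simp: nn_integral_cmult)
  also have "\<dots> = (\<Sum>n. ennreal (real n * ((r * measure lborel A) ^ n / fact n
      * exp (- (r * measure lborel A)))) * emeasure M F)"
  proof (rule suminf_cong)
    fix n
    define q where "q = (r * measure lborel A) ^ n / fact n * exp (- (r * measure lborel A))"
    have "q \<ge> 0" unfolding q_def using intensity by simp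
    moreover have "prob (N n \<inter> F) = q * prob F"
      unfolding N_def F(2) prob_count[OF A] q_def ..
    ultimately have "of_nat n * emeasure M (N n \<inter> F) = ennreal (real n * q) * emeasure M F"
      by (simp add: emeasure_eq_measure ennreal_mult ennreal_of_nat_eq_real_of_nat mult.assoc)
    then show "of_nat n * emeasure M (N n \<inter> F) = ennreal (real n * ((r * measure lborel A) ^ n / fact n
      * exp (- (r * measure lborel A)))) * emeasure M F" by (simp only: q_def)
  qed
  also have "\<dots> = ennreal (r * measure lborel A) * emeasure M F"
    unfolding ennreal_suminf_multc by (subst poisson_mean) (use intensity in auto)
  finally show ?thesis
    using intensity by (simp add: lA ennreal_mult)
qed

end

text \<open>\<open>W\<close> stands for the field values. Independence is required between
  \<open>W\<close> and counts only, not between \<open>W\<close> and the single points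
  \<open>\<xi> k\<close>, because the order of the enumeration may depend on
  \<open>W\<close>.\<close>

locale marked_poisson_points = poisson_points M r X for M :: "'w measure" and r X +
  fixes \<xi> :: "nat \<Rightarrow> 'w \<Rightarrow> real" and S :: "'b measure" and W :: "'w \<Rightarrow> 'b"
  assumes enum: "enumerates M X \<xi>"
    and W [measurable]: "W \<in> measurable M S"
    and indep_counts: "\<And>A C n. A \<in> sets borel \<Longrightarrow> bounded A \<Longrightarrow> C \<in> sets S \<Longrightarrow>
      prob ({\<omega> \<in> space M. card (X \<omega> \<inter> A) = n} \<inter> (W -` C \<inter> space M))
        = prob {\<omega> \<in> space M. card (X \<omega> \<inter> A) = n} * prob (W -` C \<inter> space M)"
begin

lemma enum_measurable [measurable]: "\<xi> k \<in> borel_measurable M"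
  using enum by (rule enumerates_measurable)

lemma marked_points_measurable [measurable]:
  "(\<lambda>p. (W (fst p), \<xi> (snd p) (fst p))) \<in> measurable (M \<Otimes>\<^sub>M count_space UNIV) (S \<Otimes>\<^sub>M borel)"
proof -
  have "(\<lambda>p. \<xi> (snd p) (fst p)) \<in> borel_measurable (M \<Otimes>\<^sub>M count_space UNIV)"
    by (rule measurable_compose_countable[where g=snd]) measurable
  then show ?thesis by measurable
qed

text \<open>This is the mean measure of the points marked by \<open>W\<close>. On a rectangle,
  counting indices \<open>k\<close> with \<open>\<xi> k\<close> in a set counts the points of
  \<open>X\<close> there, so the order of the enumeration disappears and the independence of counts
  and \<open>W\<close> gives the product.\<close>

lemma marked_points_law:
  "distr (M \<Otimes>\<^sub>M count_space UNIV) (S \<Otimes>\<^sub>M borel) (\<lambda>p. (W (fst p), \<xi> (snd p) (fst p)))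
    = distr M S W \<Otimes>\<^sub>M density lborel (\<lambda>_. ennreal r)" (is "?D = ?P \<Otimes>\<^sub>M ?L")
proof (rule pair_measure_eqI[symmetric])
  interpret P: prob_space ?P by (rule prob_space_distr) simp
  interpret cs: sigma_finite_measure "count_space (UNIV :: nat set)"
    by (rule sigma_finite_measure_count_space)
  show "sigma_finite_measure ?P" ..
  show "sigma_finite_measure ?L"
    by (subst sigma_finite_measure.sigma_finite_iff_density_finite[OF sigma_finite_lborel]) auto
  show "sets (?P \<Otimes>\<^sub>M ?L) = sets ?D" by (simp cong: sets_pair_measure_cong)
  fix A B assume "A \<in> sets ?P" and "B \<in> sets ?L"
  then have A [measurable]: "A \<in> sets S" and B [measurable]: "B \<in> sets borel" by auto
  \<comment> \<open>The law of the counts is prescribed for bounded sets only, so the identity is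
    first proved on windows and then extended by monotone continuity.\<close>
  define B' where "B' n = B \<inter> {- real n..real n}" for n
  have B' [measurable]: "B' n \<in> sets borel" "bounded (B' n)" for n
    unfolding B'_def by (auto intro: bounded_subset[of "{- real n..real n}"])
  have UB: "(\<Union>n. B' n) = B"
  proof
    show "B \<subseteq> (\<Union>n. B' n)"
    proof
      fix x assume "x \<in> B"
      obtain n where "\<bar>x\<bar> \<le> real n" using real_arch_simple by blast
      then have "- real n \<le> x" "x \<le> real n" by linarith+
      then show "x \<in> (\<Union>n. B' n)" using \<open>x \<in> B\<close> by (auto simp: B'_def)
    qed
  qed (auto simp: B'_def)
  have inc: "incseq B'" unfolding B'_def incseq_def by auto
  have L: "emeasure ?L C = ennreal r * emeasure lborel C" if "C \<in> sets borel" for C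
    using that by (simp add: emeasure_density nn_integral_cmult)
  have "emeasure ?D (A \<times> B' n) = emeasure ?P A * emeasure ?L (B' n)" for n
  proof -
    have "emeasure ?D (A \<times> B' n) = (\<integral>\<^sup>+p. indicator (A \<times> B' n) p \<partial>?D)"
      by (rule nn_integral_indicator[symmetric]) simp
    also have "\<dots> = (\<integral>\<^sup>+p. indicator (A \<times> B' n) (W (fst p), \<xi> (snd p) (fst p)) \<partial>(M \<Otimes>\<^sub>M count_space UNIV))"
      by (rule nn_integral_distr) (auto intro!: marked_points_measurable)
    also have "\<dots> = (\<integral>\<^sup>+\<omega>. \<integral>\<^sup>+k. indicator (A \<times> B' n) (W \<omega>, \<xi> k \<omega>) \<partial>count_space UNIV \<partial>M)"
      by (subst cs.nn_integral_fst[symmetric]) auto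
    also have "\<dots> = (\<integral>\<^sup>+\<omega>. of_nat (card (X \<omega> \<inter> B' n)) * indicator (W -` A \<inter> space M) \<omega> \<partial>M)"
    proof (rule nn_integral_cong_AE, use AE_infinite AE_space in eventually_elim)
      case (elim \<omega>)
      \<comment> \<open>With infinitely many points every index belongs to a point. For a finite
        configuration, values of \<xi> beyond the cardinality could fall into \<open>B' n\<close>
        and spoil the count.\<close>
      have bij: "bij_betw (\<lambda>k. \<xi> k \<omega>) {k. \<xi> k \<omega> \<in> B' n} (X \<omega> \<inter> B' n)"
        using enumerates_bij[OF enum elim(2,1)] by (auto simp: bij_betw_def inj_on_def)
      have fin: "finite {k. \<xi> k \<omega> \<in> B' n}"
        using bij_betw_finite[OF bij] finite_window[OF elim(2) B'(2)] by simp
      have "(\<integral>\<^sup>+k. indicator (A \<times> B' n) (W \<omega>, \<xi> k \<omega>) \<partial>count_space UNIV)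
          = (\<integral>\<^sup>+k. indicator A (W \<omega>) * indicator {k. \<xi> k \<omega> \<in> B' n} k \<partial>count_space UNIV)"
        by (intro nn_integral_cong) (auto split: split_indicator)
      also have "\<dots> = indicator A (W \<omega>) * emeasure (count_space UNIV) {k. \<xi> k \<omega> \<in> B' n}"
        by (simp add: nn_integral_cmult)
      also have "\<dots> = indicator A (W \<omega>) * of_nat (card (X \<omega> \<inter> B' n))"
        using fin bij_betw_same_card[OF bij] by simp
      finally show ?case using elim by (simp add: indicator_def mult.commute)
    qed
    also have "\<dots> = ennreal r * emeasure lborel (B' n) * emeasure M (W -` A \<inter> space M)"
      by (rule expected_count[OF B' _ indep_counts[OF B' A]]) simp
    finally show ?thesis
      by (simp add: emeasure_distr L mult_ac)
  qed
  then have "(\<lambda>n. emeasure ?D (A \<times> B' n)) = (\<lambda>n. emeasure ?P A * emeasure ?L (B' n))" by simp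
  moreover have "(\<lambda>n. emeasure ?D (A \<times> B' n)) \<longlonglongrightarrow> emeasure ?D (\<Union>n. A \<times> B' n)"
    by (rule Lim_emeasure_incseq) (use inc in \<open>auto simp: incseq_def\<close>)
  moreover have "(\<lambda>n. emeasure ?P A * emeasure ?L (B' n)) \<longlonglongrightarrow> emeasure ?P A * emeasure ?L (\<Union>n. B' n)"
    by (intro ennreal_tendsto_cmult Lim_emeasure_incseq inc) (auto simp: less_top[symmetric])
  moreover have "(\<Union>n. A \<times> B' n) = A \<times> B" using UB by auto
  ultimately have "emeasure ?D (A \<times> B) = emeasure ?P A * emeasure ?L (\<Union>n. B' n)"
    by (auto intro: LIMSEQ_unique)
  then show "emeasure ?P A * emeasure ?L B = emeasure ?D (A \<times> B)" by (simp only: UB)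
qed

text \<open>Both sides are the integral of \<open>h\<close> against the mean measure of the marked
  points: once through its representation by the enumeration, once through its product form, with
  Tonelli on each side.\<close>

theorem nn_Campbell:
  assumes h [measurable]: "h \<in> borel_measurable (S \<Otimes>\<^sub>M borel)"
  shows "(\<integral>\<^sup>+\<omega>. (\<Sum>k. h (W \<omega>, \<xi> k \<omega>)) \<partial>M) = (\<integral>\<^sup>+\<omega>. \<integral>\<^sup>+x. ennreal r * h (W \<omega>, x) \<partial>lborel \<partial>M)"
proof -
  let ?P = "distr M S W" and ?L = "density lborel (\<lambda>_. ennreal r)"
  interpret cs: sigma_finite_measure "count_space (UNIV :: nat set)"
    by (rule sigma_finite_measure_count_space)
  interpret L: sigma_finite_measure ?L
    by (subst sigma_finite_measure.sigma_finite_iff_density_finite[OF sigma_finite_lborel]) auto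
  have hL [measurable]: "h \<in> borel_measurable (S \<Otimes>\<^sub>M ?L)" "h \<in> borel_measurable (?P \<Otimes>\<^sub>M ?L)"
    using h by (simp_all cong: measurable_cong_sets sets_pair_measure_cong)
  have "(\<integral>\<^sup>+\<omega>. (\<Sum>k. h (W \<omega>, \<xi> k \<omega>)) \<partial>M)
      = (\<integral>\<^sup>+\<omega>. \<integral>\<^sup>+k. h (W \<omega>, \<xi> k \<omega>) \<partial>count_space UNIV \<partial>M)"
    by (simp add: nn_integral_count_space_nat)
  also have "\<dots> = (\<integral>\<^sup>+p. h (W (fst p), \<xi> (snd p) (fst p)) \<partial>(M \<Otimes>\<^sub>M count_space UNIV))"
    using cs.nn_integral_fst[of "\<lambda>p. h (W (fst p), \<xi> (snd p) (fst p))" M] by simp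
  also have "\<dots> = (\<integral>\<^sup>+p. h p \<partial>(?P \<Otimes>\<^sub>M ?L))"
    unfolding marked_points_law[symmetric] by (simp add: nn_integral_distr)
  also have "\<dots> = (\<integral>\<^sup>+s. \<integral>\<^sup>+x. h (s, x) \<partial>?L \<partial>?P)"
    by (rule L.nn_integral_fst[symmetric]) (rule hL)
  also have "\<dots> = (\<integral>\<^sup>+\<omega>. \<integral>\<^sup>+x. h (W \<omega>, x) \<partial>?L \<partial>M)"
    by (rule nn_integral_distr) (auto intro!: L.borel_measurable_nn_integral_fst)
  also have "\<dots> = (\<integral>\<^sup>+\<omega>. \<integral>\<^sup>+x. ennreal r * h (W \<omega>, x) \<partial>lborel \<partial>M)"
    using measurable_space[OF W] by (intro nn_integral_cong nn_integral_density) auto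
  finally show ?thesis .
qed

text \<open>The finiteness condition is, by the nonnegative version, integrability of
  \<open>h\<close> along the enumeration, so Fubini replaces Tonelli.\<close>

theorem Campbell:
  fixes h :: "'b \<times> real \<Rightarrow> real"
  assumes h [measurable]: "h \<in> borel_measurable (S \<Otimes>\<^sub>M borel)"
    and fin: "(\<integral>\<^sup>+\<omega>. \<integral>\<^sup>+x. ennreal r * ennreal \<bar>h (W \<omega>, x)\<bar> \<partial>lborel \<partial>M) < \<infinity>"
  shows "expectation (\<lambda>\<omega>. \<Sum>k. h (W \<omega>, \<xi> k \<omega>)) = expectation (\<lambda>\<omega>. LINT x|lborel. r * h (W \<omega>, x))"
proof -
  let ?P = "distr M S W" and ?L = "density lborel (\<lambda>_. ennreal r)"
  interpret P: prob_space ?P by (rule prob_space_distr) simp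
  interpret cs: sigma_finite_measure "count_space (UNIV :: nat set)"
    by (rule sigma_finite_measure_count_space)
  interpret L: sigma_finite_measure ?L
    by (subst sigma_finite_measure.sigma_finite_iff_density_finite[OF sigma_finite_lborel]) auto
  interpret PL: pair_sigma_finite ?P ?L ..
  interpret Mc: pair_sigma_finite M "count_space (UNIV :: nat set)" ..
  have hL [measurable]: "h \<in> borel_measurable (S \<Otimes>\<^sub>M ?L)" "h \<in> borel_measurable (?P \<Otimes>\<^sub>M ?L)"
    using h by (simp_all cong: measurable_cong_sets sets_pair_measure_cong)
  have int_Mc: "integrable (M \<Otimes>\<^sub>M count_space UNIV) (\<lambda>p. h (W (fst p), \<xi> (snd p) (fst p)))"
  proof (rule integrableI_bounded)
    have "(\<integral>\<^sup>+p. ennreal (norm (h (W (fst p), \<xi> (snd p) (fst p)))) \<partial>(M \<Otimes>\<^sub>M count_space UNIV))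
        = (\<integral>\<^sup>+\<omega>. \<integral>\<^sup>+k. ennreal \<bar>h (W \<omega>, \<xi> k \<omega>)\<bar> \<partial>count_space UNIV \<partial>M)"
      by (subst cs.nn_integral_fst[symmetric]) simp_all
    also have "\<dots> = (\<integral>\<^sup>+\<omega>. (\<Sum>k. ennreal \<bar>h (W \<omega>, \<xi> k \<omega>)\<bar>) \<partial>M)"
      by (simp add: nn_integral_count_space_nat)
    also have "\<dots> = (\<integral>\<^sup>+\<omega>. \<integral>\<^sup>+x. ennreal r * ennreal \<bar>h (W \<omega>, x)\<bar> \<partial>lborel \<partial>M)"
      by (rule nn_Campbell) measurable
    finally show "(\<integral>\<^sup>+p. ennreal (norm (h (W (fst p), \<xi> (snd p) (fst p)))) \<partial>(M \<Otimes>\<^sub>M count_space UNIV)) < \<infinity>"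
      using fin by simp
  qed simp
  have int_PL: "integrable (?P \<Otimes>\<^sub>M ?L) h"
    unfolding marked_points_law[symmetric] using int_Mc by (simp add: integrable_distr_eq)
  have "AE \<omega> in M. integrable (count_space UNIV) (\<lambda>k. h (W \<omega>, \<xi> k \<omega>))"
    using Mc.AE_integrable_fst'[OF int_Mc] by simp
  \<comment> \<open>The series agrees with the integral over the counting measure where it converges
    absolutely, which holds almost surely.\<close>
  then have "expectation (\<lambda>\<omega>. \<Sum>k. h (W \<omega>, \<xi> k \<omega>))
      = (LINT \<omega>|M. LINT k|count_space UNIV. h (W \<omega>, \<xi> k \<omega>))"
    by (intro integral_cong_AE) (auto simp: integral_count_space_nat)
  also have "\<dots> = (LINT p|(M \<Otimes>\<^sub>M count_space UNIV). h (W (fst p), \<xi> (snd p) (fst p)))"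
    using Mc.integral_fst'[OF int_Mc] by simp
  also have "\<dots> = (LINT p|(?P \<Otimes>\<^sub>M ?L). h p)"
    unfolding marked_points_law[symmetric] by (simp add: integral_distr)
  also have "\<dots> = (LINT s|?P. LINT x|?L. h (s, x))"
    by (rule PL.integral_fst'[symmetric, OF int_PL])
  also have "\<dots> = (LINT \<omega>|M. LINT x|?L. h (W \<omega>, x))"
    by (rule integral_distr) (auto intro!: L.borel_measurable_lebesgue_integral)
  also have "\<dots> = expectation (\<lambda>\<omega>. LINT x|lborel. r * h (W \<omega>, x))"
    using measurable_space[OF W] intensity
    by (intro Bochner_Integration.integral_cong[OF refl]) (subst integral_density, auto)
  finally show ?thesis .
qed

end

section \<open>Gaussian laws\<close>

text \<open>The square root of a negative number is negative, so for every real s the variance is the absolute value of s.\<close>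

lemma normal_law_eq_distr:
  "normal_law 0 s = distr std_normal_distribution borel (\<lambda>z. sqrt \<bar>s\<bar> * z)"
proof (cases "s = 0")
  case True
  interpret prob_space std_normal_distribution by (rule prob_space_normal_density) simp
  show ?thesis using True by (simp add: normal_law_def)
next
  case False
  interpret prob_space std_normal_distribution by (rule prob_space_normal_density) simp
  have "distributed std_normal_distribution lborel (\<lambda>x. x) std_normal_density"
    by (auto simp: distributed_def distr_id2)
  from normal_density_affine[OF this, of "sqrt \<bar>s\<bar>" 0] False
  have "distr std_normal_distribution lborel (\<lambda>z. sqrt \<bar>s\<bar> * z) = density lborel (normal_density 0 (sqrt \<bar>s\<bar>))"
    by (auto simp: distributed_def)
  \<comment> \<open>The density depends on the standard deviation only through its square, so the
    sign of \<open>sqrt s\<close> is immaterial.\<close>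
  moreover have "normal_density 0 (sqrt \<bar>s\<bar>) = normal_density 0 (sqrt s)"
  proof -
    have "(sqrt s)\<^sup>2 = \<bar>s\<bar>" by (simp add: power2_eq_square)
    then show ?thesis by (simp add: normal_density_def fun_eq_iff)
  qed
  moreover have "distr std_normal_distribution lborel (\<lambda>z. sqrt \<bar>s\<bar> * z) = distr std_normal_distribution borel (\<lambda>z. sqrt \<bar>s\<bar> * z)"
    by (rule distr_cong) auto
  ultimately show ?thesis using False by (simp add: normal_law_def)
qed

lemma char_normal_law: "char (normal_law 0 s) t = exp (- (\<bar>s\<bar> * t\<^sup>2) / 2)"
proof -
  have "char (normal_law 0 s) t = char std_normal_distribution (sqrt \<bar>s\<bar> * t)"
    unfolding normal_law_eq_distr char_def by (subst integral_distr) (auto simp: mult_ac)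
  also have "\<dots> = exp (- (\<bar>s\<bar> * t\<^sup>2) / 2)"
    by (simp add: char_std_normal_distribution power_mult_distrib exp_of_real)
  finally show ?thesis .
qed

lemma real_distribution_normal_law: "real_distribution (normal_law 0 s)"
proof -
  interpret prob_space std_normal_distribution by (rule prob_space_normal_density) simp
  show ?thesis unfolding normal_law_eq_distr by simp
qed

text \<open>Characteristic functions multiply and determine the law. They treat degenerate summands
  like the others, which matters because an edge containing neither of two points contributes 0 to
  the increment between them. The absolute values appear since the parameters \<open>s i\<close> are
  not assumed nonnegative.\<close>

lemma (in prob_space) distr_sum_indep_normal:
  fixes X :: "'i \<Rightarrow> 'a \<Rightarrow> real"
  assumes "indep_vars (\<lambda>_. borel) X I" "finite I" "\<And>i. i \<in> I \<Longrightarrow> distr M borel (X i) = normal_law 0 (s i)"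
  shows "distr M borel (\<lambda>\<omega>. \<Sum>i\<in>I. X i \<omega>) = normal_law 0 (\<Sum>i\<in>I. \<bar>s i\<bar>)"
proof (rule Levy_uniqueness)
  have [measurable]: "X i \<in> borel_measurable M" if "i \<in> I" for i
    using assms(1) that by (auto simp: indep_vars_def)
  show "real_distribution (distr M borel (\<lambda>\<omega>. \<Sum>i\<in>I. X i \<omega>))" by simp
  show "real_distribution (normal_law 0 (\<Sum>i\<in>I. \<bar>s i\<bar>))" by (rule real_distribution_normal_law)
  show "char (distr M borel (\<lambda>\<omega>. \<Sum>i\<in>I. X i \<omega>)) = char (normal_law 0 (\<Sum>i\<in>I. \<bar>s i\<bar>))"
  proof
    fix t
    have "(\<Prod>i\<in>I. exp (- (\<bar>s i\<bar> * t\<^sup>2) / 2)) = exp (\<Sum>i\<in>I. - (\<bar>s i\<bar> * t\<^sup>2) / 2)"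
      using assms(2) by (simp add: exp_sum)
    also have "(\<Sum>i\<in>I. - (\<bar>s i\<bar> * t\<^sup>2) / 2) = - (\<bar>\<Sum>i\<in>I. \<bar>s i\<bar>\<bar> * t\<^sup>2) / 2"
      by (simp add: sum_distrib_right sum_negf sum_divide_distrib abs_of_nonneg sum_nonneg)
    finally have "(\<Prod>i\<in>I. exp (- (\<bar>s i\<bar> * t\<^sup>2) / 2)) = exp (- (\<bar>\<Sum>i\<in>I. \<bar>s i\<bar>\<bar> * t\<^sup>2) / 2)" .
    moreover have "char (distr M borel (\<lambda>\<omega>. \<Sum>i\<in>I. X i \<omega>)) t
        = complex_of_real (\<Prod>i\<in>I. exp (- (\<bar>s i\<bar> * t\<^sup>2) / 2))"
      unfolding char_distr_sum[OF assms(1)] of_real_prod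
      by (intro prod.cong refl) (simp add: assms(3) char_normal_law)
    ultimately show "char (distr M borel (\<lambda>\<omega>. \<Sum>i\<in>I. X i \<omega>)) t = char (normal_law 0 (\<Sum>i\<in>I. \<bar>s i\<bar>)) t"
      by (simp add: char_normal_law)
  qed
qed

text \<open>Both parts come from representing \<open>W\<close> as \<open>sqrt \<bar>s\<bar>\<close>
  times a standard normal variable. The second part identifies an unknown parameter
  \<open>s\<close>, up to sign, with the variance, and the first part depends on
  \<open>\<bar>s\<bar>\<close> alone.\<close>

lemma (in prob_space)
  fixes W :: "'a \<Rightarrow> real"
  assumes [measurable]: "W \<in> borel_measurable M" and law: "distr M borel W = normal_law 0 s"
  shows expectation_normal_law: "g \<in> borel_measurable borel \<Longrightarrow>
      expectation (\<lambda>\<omega>. g (W \<omega>)) = (LINT z|lborel. std_normal_density z * g (sqrt \<bar>s\<bar> * z))"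
    and variance_normal_law: "variance W = \<bar>s\<bar>"
proof -
  have *: "expectation (\<lambda>\<omega>. g (W \<omega>)) = (LINT z|std_normal_distribution. g (sqrt \<bar>s\<bar> * z))"
    if [measurable]: "g \<in> borel_measurable borel" for g :: "real \<Rightarrow> real"
  proof -
    have "expectation (\<lambda>\<omega>. g (W \<omega>)) = (LINT x|distr M borel W. g x)"
      by (simp add: integral_distr)
    also have "\<dots> = (LINT z|std_normal_distribution. g (sqrt \<bar>s\<bar> * z))"
      unfolding law normal_law_eq_distr by (simp add: integral_distr)
    finally show ?thesis .
  qed
  show "expectation (\<lambda>\<omega>. g (W \<omega>)) = (LINT z|lborel. std_normal_density z * g (sqrt \<bar>s\<bar> * z))"
    if [measurable]: "g \<in> borel_measurable borel"
    using *[OF that] by (simp add: integral_density)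
  have m: "expectation W = 0"
    using *[of "\<lambda>x. x"] integral_std_normal_distribution_moment_odd[of 1] by simp
  have "variance W = (LINT z|std_normal_distribution. \<bar>s\<bar> * z\<^sup>2)"
    using *[of "\<lambda>x. x\<^sup>2"] by (simp add: m power_mult_distrib)
  also have "\<dots> = \<bar>s\<bar>"
    using std_normal_distribution_even_moments(1)[of 1] by simp
  finally show "variance W = \<bar>s\<bar>" .
qed

section \<open>Increments of the auxiliary field\<close>

lemma (in prob_space) indep_vars_of_indep_sets:
  assumes "indep_sets F I"
    and "\<And>i. i \<in> I \<Longrightarrow> X i \<in> measurable M (N i)"
    and "\<And>i A. i \<in> I \<Longrightarrow> A \<in> sets (N i) \<Longrightarrow> X i -` A \<inter> space M \<in> F i"
  shows "indep_vars N X I"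
  unfolding indep_vars_def2 using assms by (auto intro!: indep_sets_mono_sets[OF assms(1)])

lemma centred_gaussian_lincomb:
  assumes "centred_gaussian M I X S" "finite J" "J \<subseteq> I"
  shows "\<exists>s. distr M borel (\<lambda>\<omega>. \<Sum>i\<in>J. a i * X i \<omega>) = normal_law 0 s"
  using assms unfolding centred_gaussian_def by blast

section \<open>Charts and end vertices of edges, and Gaussian increments along them\<close>

lemma finite_edges: "euclidean_graph G \<Longrightarrow> finite (edges G)"
  unfolding euclidean_graph_def by (rule finite_subset[of _ "Pow (vertices G)"]) auto

lemma edge_chart:
  assumes "euclidean_graph G" "e \<in> edges G"
  shows "edge_lo G e < edge_hi G e" "chart G e ` edge_points G e = {edge_lo G e<..<edge_hi G e}"
    "chart G e ` e = {edge_lo G e, edge_hi G e}" "inj_on (chart G e) e" "e \<subseteq> vertices G"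
proof -
  have chart: "inj_on (chart G e) (edge_points G e \<union> e)
      \<and> (\<exists>a b. a < b \<and> chart G e ` edge_points G e = {a<..<b} \<and> chart G e ` e = {a, b})"
    using assms unfolding euclidean_graph_def by (elim conjE) (rule bspec)
  then obtain a b where ab: "a < b" "chart G e ` edge_points G e = {a<..<b}" "chart G e ` e = {a, b}"
    by blast
  then have "edge_lo G e = a" "edge_hi G e = b" unfolding edge_lo_def edge_hi_def by auto
  with ab show "edge_lo G e < edge_hi G e" "chart G e ` edge_points G e = {edge_lo G e<..<edge_hi G e}"
    "chart G e ` e = {edge_lo G e, edge_hi G e}" by auto
  from chart show "inj_on (chart G e) e" by (blast intro: inj_on_subset)
  have "edges G \<subseteq> {{u, v} |u v. u \<in> vertices G \<and> v \<in> vertices G \<and> u \<noteq> v}"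
    using assms(1) unfolding euclidean_graph_def by (elim conjE)
  with assms(2) show "e \<subseteq> vertices G" by auto
qed

lemma chart_edge_point:
  assumes "euclidean_graph G" "e \<in> edges G" "u \<in> edge_points G e"
  shows "chart G e u \<in> {edge_lo G e..edge_hi G e}"
proof -
  have "chart G e u \<in> {edge_lo G e<..<edge_hi G e}"
    using assms(3) edge_chart(2)[OF assms(1,2)] by blast
  then show ?thesis by auto
qed

text \<open>This checks that the definite descriptions denote: disjointness of the edge sets makes
  the host edge unique, and injectivity of its chart on the two end points makes the vertex with a
  given end value unique.\<close>

lemma end_vertices:
  assumes G: "euclidean_graph G" and u: "u \<in> points G"
  shows "lower_vertex G u \<in> vertices G" "upper_vertex G u \<in> vertices G"
proof -
  have the: "(THE v. v \<in> e \<and> chart G e v = c) \<in> e"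
    if "e \<in> edges G" "c \<in> {edge_lo G e, edge_hi G e}" for e c
  proof -
    have "c \<in> chart G e ` e" unfolding edge_chart(3)[OF G that(1)] by (rule that(2))
    then have "\<exists>!v. v \<in> e \<and> chart G e v = c"
      using edge_chart(4)[OF G that(1)] by (auto dest: inj_onD)
    from theI'[OF this] show ?thesis by blast
  qed
  have host: "host_edge G u \<in> edges G" if notv: "u \<notin> vertices G"
  proof -
    obtain e where e: "e \<in> edges G" "u \<in> edge_points G e"
      using u notv unfolding points_def by auto
    have "disjoint_family_on (edge_points G) (edges G)"
      using G unfolding euclidean_graph_def by blast
    then have uniq: "e' = e" if "e' \<in> edges G \<and> u \<in> edge_points G e'" for e'
      using e that disjoint_family_onD[of "edge_points G" "edges G" e' e] by auto
    have "\<exists>!e. e \<in> edges G \<and> u \<in> edge_points G e"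
    proof (rule ex1I)
      show "e \<in> edges G \<and> u \<in> edge_points G e" using e by blast
    qed (rule uniq)
    from theI'[OF this] show ?thesis unfolding host_edge_def ..
  qed
  show "lower_vertex G u \<in> vertices G"
    using the[OF host] edge_chart(5)[OF G host] unfolding lower_vertex_def by auto
  show "upper_vertex G u \<in> vertices G"
    using the[OF host] edge_chart(5)[OF G host] unfolding upper_vertex_def by auto
qed

lemma sum_of_bool_mult:
  fixes g :: "'a \<Rightarrow> real"
  assumes "finite V" "l \<in> V"
  shows "(\<Sum>w\<in>V. of_bool (w = l) * g w) = g l"
  using assms by (simp add: of_bool_def if_distrib[of "\<lambda>x. x * _"] cong: if_cong)

text \<open>The increment is a sum of one component for the interpolated vertex field (index
  \<open>None\<close>) and one for each edge. Every component is a finite linear combination within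
  its own Gaussian family, hence normal, and the components are independent because each is
  measurable with respect to its own generated sigma-algebra.\<close>

lemma (in prob_space) auxiliary_field_gaussian:
  fixes G :: "'b egraph"
  assumes G: "euclidean_graph G" and aux: "auxiliary_field M G u0 Z"
    and u: "u \<in> points G" and v: "v \<in> points G"
  shows "Z u \<in> borel_measurable M" "\<exists>s. distr M borel (\<lambda>\<omega>. Z u \<omega> - Z v \<omega>) = normal_law 0 s"
proof -
  obtain Zmu B S where
      gauss: "centred_gaussian M (vertices G) Zmu S"
    and bridge: "\<And>e. e \<in> edges G \<Longrightarrow> brownian_bridge M (edge_lo G e) (edge_hi G e) (B e)"
    and indep: "indep_sets (case_option (generated_events M (vertices G) Zmu)
             (\<lambda>e. generated_events M {edge_lo G e..edge_hi G e} (B e))) (insert None (Some ` edges G))"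
    and Z: "\<And>x \<omega>. x \<in> points G \<Longrightarrow> \<omega> \<in> space M \<Longrightarrow>
          Z x \<omega> = vertex_field G Zmu x \<omega> + (\<Sum>e\<in>edges G. edge_field G B e x \<omega>)"
    using aux unfolding auxiliary_field_def by blast
  have finV: "finite (vertices G)" using G unfolding euclidean_graph_def by blast
  define F where "F = case_option (generated_events M (vertices G) Zmu)
             (\<lambda>e. generated_events M {edge_lo G e..edge_hi G e} (B e))"
  define I where "I = insert None (Some ` edges G)"
  define C where "C x = case_option (vertex_field G Zmu x) (\<lambda>e. edge_field G B e x)" for x
  define D where "D i \<omega> = C u i \<omega> - C v i \<omega>" for i \<omega>
  have finI: "finite I" unfolding I_def using finite_edges[OF G] by simp
  have Z_eq: "Z x \<omega> = (\<Sum>i\<in>I. C x i \<omega>)" if "x \<in> points G" "\<omega> \<in> space M" for x \<omega>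
    unfolding I_def using finite_edges[OF G]
    by (simp add: Z[OF that] C_def sum.reindex)
  have FPow: "F i \<subseteq> Pow (space M)" "F i \<subseteq> sets M" if "i \<in> I" for i
  proof -
    show "F i \<subseteq> sets M" using indep that unfolding F_def I_def indep_sets_def by blast
    then show "F i \<subseteq> Pow (space M)" using sets.sets_into_space by blast
  qed
  have F_eq: "sets (sigma (space M) (F i)) = F i" for i
    unfolding F_def by (cases i) (simp_all add: sets_sigma_generated_events)
  have C_meas: "C x i \<in> borel_measurable (sigma (space M) (F i))" if x: "x \<in> points G" and i: "i \<in> I" for x i
  proof (cases i)
    case None
    have [measurable]: "Zmu w \<in> borel_measurable (sigma (space M) (F i))" if "w \<in> vertices G" for w
      by (rule measurable_sigma_generated[OF _ FPow(1)[OF i] that]) (simp add: F_def None)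
    have "(\<lambda>\<omega>. (1 - rel_position G x) * Zmu (lower_vertex G x) \<omega>
        + rel_position G x * Zmu (upper_vertex G x) \<omega>) \<in> borel_measurable (sigma (space M) (F i))"
      using end_vertices[OF G x] by measurable
    then show ?thesis by (simp add: C_def None vertex_field_def[abs_def])
  next
    case (Some e)
    then have e: "e \<in> edges G" using i unfolding I_def by auto
    have "B e p \<in> borel_measurable (sigma (space M) (F i))" if "p \<in> {edge_lo G e..edge_hi G e}" for p
      by (rule measurable_sigma_generated[OF _ FPow(1)[OF i] that]) (simp add: F_def Some)
    then have "(\<lambda>\<omega>. if x \<in> edge_points G e then B e (chart G e x) \<omega> else 0)
        \<in> borel_measurable (sigma (space M) (F i))"
      using chart_edge_point[OF G e, of x] by (cases "x \<in> edge_points G e") simp_all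
    then show ?thesis by (simp add: C_def Some edge_field_def[abs_def])
  qed
  have sub: "borel_measurable (sigma (space M) (F i)) \<subseteq> (borel_measurable M :: ('a \<Rightarrow> real) set)" if "i \<in> I" for i
    using FPow[OF that] F_eq[of i] by (intro measurable_mono) (auto simp: space_measure_of_conv)
  have C_rv [measurable]: "C x i \<in> borel_measurable M" if "x \<in> points G" "i \<in> I" for x i
    using C_meas[OF that] sub[OF that(2)] by blast
  have "(\<lambda>\<omega>. \<Sum>i\<in>I. C u i \<omega>) \<in> borel_measurable M" using u by measurable
  then show "Z u \<in> borel_measurable M"
    by (subst measurable_cong[OF Z_eq[OF u]])
  have D_meas: "D i \<in> borel_measurable (sigma (space M) (F i))" if "i \<in> I" for i
    unfolding D_def using C_meas[OF u that] C_meas[OF v that] by measurable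
  have ind: "indep_vars (\<lambda>_. borel) D I"
  proof (rule indep_vars_of_indep_sets)
    show "indep_sets F I" using indep unfolding F_def I_def .
    show "D i \<in> borel_measurable M" if "i \<in> I" for i using D_meas[OF that] sub[OF that] by blast
    show "D i -` A \<inter> space M \<in> F i" if "i \<in> I" "A \<in> sets borel" for i A
      using measurable_sets[OF D_meas[OF that(1)] that(2)] F_eq[of i] by (simp add: space_measure_of_conv)
  qed
  have "\<exists>s. distr M borel (D i) = normal_law 0 s" if i: "i \<in> I" for i
  proof (cases i)
    case None
    \<comment> \<open>These are the interpolation weights on the vertices. The two terms are added,
      so that a vertex \<open>x\<close>, with both end vertices equal to \<open>x\<close>, receives
      total weight 1.\<close>
    define a where "a x w = (1 - rel_position G x) * of_bool (w = lower_vertex G x)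
        + rel_position G x * of_bool (w = upper_vertex G x)" for x w
    have "C x i \<omega> = (\<Sum>w\<in>vertices G. a x w * Zmu w \<omega>)" if "x \<in> points G" for x \<omega>
      using end_vertices[OF G that] finV
      by (simp add: a_def C_def None vertex_field_def distrib_right sum.distrib mult.assoc
          sum_of_bool_mult flip: sum_distrib_left)
    then have "D i = (\<lambda>\<omega>. \<Sum>w\<in>vertices G. (a u w - a v w) * Zmu w \<omega>)"
      using u v by (simp add: D_def fun_eq_iff left_diff_distrib sum_subtractf)
    then show ?thesis
      using centred_gaussian_lincomb[OF gauss finV] by simp
  next
    case (Some e)
    then have e: "e \<in> edges G" using i unfolding I_def by auto
    \<comment> \<open>At most two times of the bridge matter. As \<open>J\<close> is a set, equal
      chart values are merged and their coefficients subtracted; a chart value of a point outside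
      the edge may survive in \<open>J\<close> but gets coefficient 0.\<close>
    define J where "J = {chart G e u, chart G e v} \<inter> {edge_lo G e..edge_hi G e}"
    define a :: "'b \<Rightarrow> real \<Rightarrow> real"
      where "a x p = of_bool (x \<in> edge_points G e) * of_bool (p = chart G e x)" for x p
    have J: "finite J" "J \<subseteq> {edge_lo G e..edge_hi G e}" unfolding J_def by auto
    have "C x i \<omega> = (\<Sum>p\<in>J. a x p * B e p \<omega>)" if "x = u \<or> x = v" for x \<omega>
    proof (cases "x \<in> edge_points G e")
      case True
      then have "chart G e x \<in> J" using chart_edge_point[OF G e] that unfolding J_def by auto
      then show ?thesis using True J(1) by (simp add: a_def C_def Some edge_field_def sum_of_bool_mult)
    qed (simp add: a_def C_def Some edge_field_def)
    then have "D i = (\<lambda>\<omega>. \<Sum>p\<in>J. (a u p - a v p) * B e p \<omega>)"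
      by (simp add: D_def fun_eq_iff left_diff_distrib sum_subtractf)
    moreover have "centred_gaussian M {edge_lo G e..edge_hi G e} (B e)
        (\<lambda>s t. (min s t - edge_lo G e) * (edge_hi G e - max s t) / (edge_hi G e - edge_lo G e))"
      using bridge[OF e] unfolding brownian_bridge_def ..
    ultimately show ?thesis
      using centred_gaussian_lincomb[OF _ J] by simp
  qed
  then obtain s where s: "\<And>i. i \<in> I \<Longrightarrow> distr M borel (D i) = normal_law 0 (s i)"
    by metis
  have "distr M borel (\<lambda>\<omega>. Z u \<omega> - Z v \<omega>) = distr M borel (\<lambda>\<omega>. \<Sum>i\<in>I. D i \<omega>)"
    by (rule distr_cong) (simp_all add: Z_eq u v D_def sum_subtractf)
  also have "\<dots> = normal_law 0 (\<Sum>i\<in>I. \<bar>s i\<bar>)"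
    by (rule distr_sum_indep_normal[OF ind finI s])
  finally show "\<exists>s. distr M borel (\<lambda>\<omega>. Z u \<omega> - Z v \<omega>) = normal_law 0 s" ..
qed

section \<open>Signed shot noise\<close>

text \<open>The events with values 1 and -1 are disjoint and have total probability 1, so almost
  surely the variable is a difference of two indicators and its square is 1.\<close>

lemma orthonormal_noise_random_signs:
  assumes "prob_space M" "random_signs M UNIV \<eta>"
  shows "orthonormal_noise M \<eta>"
proof -
  interpret prob_space M by fact
  have indep: "indep_vars (\<lambda>_. borel) \<eta> UNIV"
    and half: "prob {\<omega> \<in> space M. \<eta> k \<omega> = 1} = 1 / 2" "prob {\<omega> \<in> space M. \<eta> k \<omega> = - 1} = 1 / 2" for k
    using assms(2) unfolding random_signs_def by auto
  have rv [measurable]: "\<eta> k \<in> borel_measurable M" for k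
    using indep by (auto simp: indep_vars_def)
  define P where "P k = {\<omega> \<in> space M. \<eta> k \<omega> = 1}" for k
  define N where "N k = {\<omega> \<in> space M. \<eta> k \<omega> = - 1}" for k
  have [measurable]: "P k \<in> sets M" "N k \<in> sets M" for k unfolding P_def N_def by measurable
  have "prob (P k \<union> N k) = 1" for k
    using half[of k] by (subst finite_measure_Union) (auto simp: P_def N_def)
  then have "AE \<omega> in M. \<omega> \<in> P k \<union> N k" for k
    by (subst AE_in_set_eq_1) auto
  then have ae: "AE \<omega> in M. \<eta> k \<omega> = indicator (P k) \<omega> - indicator (N k) \<omega> \<and> (\<eta> k \<omega>)\<^sup>2 = 1" for k
    by (rule AE_mp) (auto simp: P_def N_def indicator_def intro!: AE_I2)
  show ?thesis
  proof
    fix k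
    have ae1: "AE \<omega> in M. \<eta> k \<omega> = indicator (P k) \<omega> - indicator (N k) \<omega>"
      and ae2: "AE \<omega> in M. (\<eta> k \<omega>)\<^sup>2 = 1"
      using ae[of k] by (auto elim: AE_mp intro!: AE_I2)
    have "integrable M (\<lambda>\<omega>. (\<eta> k \<omega>)\<^sup>2) \<longleftrightarrow> integrable M (\<lambda>_. 1 :: real)"
      using ae2 by (intro integrable_cong_AE) auto
    then show "integrable M (\<lambda>\<omega>. (\<eta> k \<omega>)\<^sup>2)" by simp
    have "expectation (\<lambda>\<omega>. (\<eta> k \<omega>)\<^sup>2) = expectation (\<lambda>_. 1 :: real)"
      using ae2 by (intro integral_cong_AE) auto
    then show "expectation (\<lambda>\<omega>. (\<eta> k \<omega>)\<^sup>2) = 1" by (simp add: prob_space)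
    have "expectation (\<eta> k) = expectation (\<lambda>\<omega>. indicator (P k) \<omega> - indicator (N k) \<omega>)"
      using ae1 by (intro integral_cong_AE) auto
    also have "\<dots> = prob (P k) - prob (N k)"
      by (subst Bochner_Integration.integral_diff) (auto simp: less_top[symmetric])
    finally show "expectation (\<eta> k) = 0" using half[of k] by (simp add: P_def N_def)
  qed (rule indep)
qed

text \<open>The series is a finite sum when only finitely many x k lie in the window; otherwise it may be a junk value.\<close>

definition windowed_series :: "(real \<Rightarrow> real) \<Rightarrow> nat \<Rightarrow> (nat \<Rightarrow> real) \<Rightarrow> real \<Rightarrow> (nat \<Rightarrow> real) \<Rightarrow> real" where
  "windowed_series f n x z e = (\<Sum>k. if \<bar>x k\<bar> \<le> real n then e k * f (z - x k) else 0)"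

text \<open>Points, field value and signs are separate arguments, so that this is a jointly
  measurable function which can be evaluated at points and signs from different samples.\<close>

definition shot_noise_sum :: "(real \<Rightarrow> real) \<Rightarrow> (nat \<Rightarrow> real) \<Rightarrow> real \<Rightarrow> (nat \<Rightarrow> real) \<Rightarrow> real" where
  "shot_noise_sum f x z e = lim (\<lambda>n. windowed_series f n x z e)"

lemma windowed_series_eq_sum:
  assumes "finite {k. \<bar>x k\<bar> \<le> real n}"
  shows "windowed_series f n x z e = (\<Sum>k\<in>{k. \<bar>x k\<bar> \<le> real n}. e k * f (z - x k))"
  unfolding windowed_series_def using assms by (subst suminf_finite[OF assms]) auto

lemma windowed_series_measurable:
  assumes f [measurable]: "f \<in> borel_measurable borel"
    and x: "\<And>k. (\<lambda>p. x p k) \<in> borel_measurable N"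
    and z [measurable]: "z \<in> borel_measurable N"
    and e: "\<And>k. (\<lambda>p. e p k) \<in> borel_measurable N"
  shows "(\<lambda>p. windowed_series f n (x p) (z p) (e p)) \<in> borel_measurable N"
proof -
  have summand: "(\<lambda>p. if \<bar>a p\<bar> \<le> real n then b p * f (z p - a p) else 0) \<in> borel_measurable N"
    if [measurable]: "a \<in> borel_measurable N" "b \<in> borel_measurable N" for a b
    by measurable
  show ?thesis
    unfolding windowed_series_def by (rule borel_measurable_suminf) (rule summand[OF x e])
qed

lemma shot_noise_sum_measurable:
  assumes "f \<in> borel_measurable borel"
    and "\<And>k. (\<lambda>p. x p k) \<in> borel_measurable N"
    and "z \<in> borel_measurable N"
    and "\<And>k. (\<lambda>p. e p k) \<in> borel_measurable N"
  shows "(\<lambda>p. shot_noise_sum f (x p) (z p) (e p)) \<in> borel_measurable N"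
  unfolding shot_noise_sum_def
  by (rule borel_measurable_lim_metric) (rule windowed_series_measurable[OF assms])

lemma nn_integral_reflect_translate:
  fixes f :: "real \<Rightarrow> ennreal"
  assumes "f \<in> borel_measurable borel"
  shows "(\<integral>\<^sup>+x. f (z - x) \<partial>lborel) = (\<integral>\<^sup>+x. f x \<partial>lborel)"
  by (subst nn_integral_real_affine[where f = f and c = "-1" and t = z]) (simp_all add: assms)

text \<open>Substitute \<open>x = w - y\<close>.\<close>

lemma covariogram_reflect:
  "(LINT x|lborel. f (z - x) * f (w - x)) = covariogram f (z - w)"
  unfolding covariogram_def
  by (subst lborel_integral_real_affine[where c = "-1" and t = w]) simp_all

text \<open>\<open>W\<close> will be the pair of field values at two points of the graph, and
  functions \<open>g\<close> of \<open>W\<close> select one of them. The assumption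
  \<open>law\<close> separates the signs from points and field jointly, which is what conditioning
  on the latter requires.\<close>

locale shot_noise = marked_poisson_points M 1 X \<xi> S W + orthonormal_noise M \<eta>
  for M :: "'w measure" and X \<xi> and S :: "'b measure" and W \<eta> +
  fixes f :: "real \<Rightarrow> real"
  assumes law: "product_law M (PiM UNIV (\<lambda>_. borel) \<Otimes>\<^sub>M S) (PiM UNIV (\<lambda>_. borel))
      (\<lambda>\<omega>. (\<lambda>k. \<xi> k \<omega>, W \<omega>)) (\<lambda>\<omega> k. \<eta> k \<omega>)"
    and f [measurable]: "f \<in> borel_measurable borel"
    and f_L2: "integrable lborel (\<lambda>x. (f x)\<^sup>2)"
begin

sublocale law: product_law M "PiM UNIV (\<lambda>_. borel) \<Otimes>\<^sub>M S" "PiM UNIV (\<lambda>_. borel)"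
  "\<lambda>\<omega>. (\<lambda>k. \<xi> k \<omega>, W \<omega>)" "\<lambda>\<omega> k. \<eta> k \<omega>"
  by (rule law)

text \<open>These index sets are determined by the points alone, so they are deterministic once
  \<omega> is frozen and the signs are read at another sample.\<close>

definition win :: "'w \<Rightarrow> nat \<Rightarrow> nat set" where
  "win \<omega> n = {k. \<bar>\<xi> k \<omega>\<bar> \<le> real n}"

lemma win_exhaustion:
  assumes "\<omega> \<in> space M" "infinite (X \<omega>)"
  shows "incseq (win \<omega>)" "finite (win \<omega> n)" "(\<Union>n. win \<omega> n) = UNIV"
    "bij_betw (\<lambda>k. \<xi> k \<omega>) (win \<omega> n) (X \<omega> \<inter> {- real n..real n})"
proof -
  show *: "bij_betw (\<lambda>k. \<xi> k \<omega>) (win \<omega> n) (X \<omega> \<inter> {- real n..real n})"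
    using enumerates_window_bij[OF enum assms(1), of n] assms(2) by (simp add: win_def)
  show "finite (win \<omega> n)"
    using bij_betw_finite[OF *] finite_window[OF assms(1)] by simp
  show "incseq (win \<omega>)" unfolding incseq_def win_def by auto
  show "(\<Union>n. win \<omega> n) = UNIV" unfolding win_def using real_arch_simple by blast
qed

lemma window_sum_eq:
  assumes "\<omega> \<in> space M" "infinite (X \<omega>)" "\<And>k. \<eta> k \<omega> = eps (\<xi> k \<omega>) \<omega>"
  shows "window_sum X eps f Z n u \<omega> = windowed_series f n (\<lambda>k. \<xi> k \<omega>) (Z u \<omega>) (\<lambda>k. \<eta> k \<omega>)"
proof -
  note win = win_exhaustion(2,4)[OF assms(1,2), of n]
  have "window_sum X eps f Z n u \<omega> = (\<Sum>k\<in>win \<omega> n. eps (\<xi> k \<omega>) \<omega> * f (Z u \<omega> - \<xi> k \<omega>))"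
    unfolding window_sum_def by (rule sum.reindex_bij_betw[OF win(2), symmetric])
  then show ?thesis
    using windowed_series_eq_sum[of "\<lambda>k. \<xi> k \<omega>" n] win(1) by (simp add: win_def assms(3))
qed

definition coefs :: "('b \<Rightarrow> real) \<Rightarrow> 'w \<Rightarrow> nat \<Rightarrow> real" where
  "coefs g \<omega> k = f (g (W \<omega>) - \<xi> k \<omega>)"

definition shot_noise_value :: "('b \<Rightarrow> real) \<Rightarrow> 'w \<Rightarrow> real" where
  "shot_noise_value g \<omega> = shot_noise_sum f (\<lambda>k. \<xi> k \<omega>) (g (W \<omega>)) (\<lambda>k. \<eta> k \<omega>)"

section \<open>Convergence and moments by averaging over the signs\<close>

lemma f_L2_finite: "(\<integral>\<^sup>+x. ennreal ((f x)\<^sup>2) \<partial>lborel) < \<infinity>"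
  using f_L2 by (simp add: nn_integral_eq_integral)

context
  fixes g :: "'b \<Rightarrow> real" assumes g [measurable]: "g \<in> borel_measurable S"
begin

text \<open>Campbell's formula gives the integral of \<open>(f (g (W \<omega>) - x))\<^sup>2\<close>
  over \<open>x\<close>, and reflection and translation invariance of Lebesgue measure removes the
  dependence on the field.\<close>

lemma expectation_coefs:
  "(\<integral>\<^sup>+\<omega>. (\<Sum>k. ennreal ((coefs g \<omega> k)\<^sup>2)) \<partial>M) = (\<integral>\<^sup>+x. ennreal ((f x)\<^sup>2) \<partial>lborel)"
proof -
  have h: "(\<lambda>p. ennreal ((f (g (fst p) - snd p))\<^sup>2)) \<in> borel_measurable (S \<Otimes>\<^sub>M borel)"
    by measurable
  have shift: "(\<integral>\<^sup>+x. ennreal 1 * ennreal ((f (z - x))\<^sup>2) \<partial>lborel) = (\<integral>\<^sup>+x. ennreal ((f x)\<^sup>2) \<partial>lborel)" for z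
    using nn_integral_reflect_translate[of "\<lambda>x. ennreal ((f x)\<^sup>2)" z] by simp
  have "(\<integral>\<^sup>+\<omega>. (\<Sum>k. ennreal ((coefs g \<omega> k)\<^sup>2)) \<partial>M)
      = (\<integral>\<^sup>+\<omega>. \<integral>\<^sup>+x. ennreal 1 * ennreal ((f (g (W \<omega>) - x))\<^sup>2) \<partial>lborel \<partial>M)"
    using nn_Campbell[OF h] unfolding coefs_def by (simp only: fst_conv snd_conv)
  also have "\<dots> = (\<integral>\<^sup>+\<omega>. (\<integral>\<^sup>+x. ennreal ((f x)\<^sup>2) \<partial>lborel) \<partial>M)"
    by (simp only: shift)
  finally show ?thesis by (simp add: emeasure_space_1)
qed

lemma AE_summable_coefs: "AE \<omega> in M. summable (\<lambda>k. (coefs g \<omega> k)\<^sup>2)"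
proof -
  have [measurable]: "(\<lambda>\<omega>. coefs g \<omega> k) \<in> borel_measurable M" for k unfolding coefs_def by measurable
  have "AE \<omega> in M. (\<Sum>k. ennreal ((coefs g \<omega> k)\<^sup>2)) \<noteq> \<infinity>"
    using expectation_coefs f_L2_finite by (intro nn_integral_PInf_AE) auto
  then show ?thesis
    by (rule AE_mp) (auto intro!: AE_I2 summable_suminf_not_top)
qed

lemma windowed_series_eq_weighted_sum:
  assumes "\<omega> \<in> space M" "infinite (X \<omega>)"
  shows "windowed_series f n (\<lambda>k. \<xi> k \<omega>) (g (W \<omega>)) (\<lambda>k. \<eta> k \<omega>') = weighted_sum (coefs g \<omega>) (win \<omega> n) \<omega>'"
  using windowed_series_eq_sum[of "\<lambda>k. \<xi> k \<omega>" n] win_exhaustion(2)[OF assms, of n]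
  by (simp add: win_def weighted_sum_def coefs_def mult.commute)

lemma shot_noise_sum_eq_series:
  assumes "\<omega> \<in> space M" "infinite (X \<omega>)"
  shows "shot_noise_sum f (\<lambda>k. \<xi> k \<omega>) (g (W \<omega>)) (\<lambda>k. \<eta> k \<omega>') = noise_series (win \<omega>) (coefs g \<omega>) \<omega>'"
  unfolding shot_noise_sum_def noise_series_def windowed_series_eq_weighted_sum[OF assms] ..

lemma shot_noise_value_measurable [measurable]: "shot_noise_value g \<in> borel_measurable M"
  unfolding shot_noise_value_def by (rule shot_noise_sum_measurable) measurable

lemma shot_noise_sum_pair_measurable:
  "(\<lambda>p. shot_noise_sum f (\<lambda>k. \<xi> k (fst p)) (g (W (fst p))) (\<lambda>k. \<eta> k (snd p))) \<in> borel_measurable (M \<Otimes>\<^sub>M M)"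
  by (rule shot_noise_sum_measurable) measurable

text \<open>For almost every frozen \<omega> the coefficients are square summable and the windows
  exhaust the indices, so the series converges for almost every sample \<omega>' of the signs; the
  product law transfers this to \<omega> = \<omega>'.\<close>

lemma AE_convergent_windowed_series:
  "AE \<omega> in M. convergent (\<lambda>n. windowed_series f n (\<lambda>k. \<xi> k \<omega>) (g (W \<omega>)) (\<lambda>k. \<eta> k \<omega>))"
proof -
  define C where "C p e \<longleftrightarrow> convergent (\<lambda>n. windowed_series f n (fst p) (g (snd p)) e)" for p e
  have "AE \<omega> in M. C (\<lambda>k. \<xi> k \<omega>, W \<omega>) (\<lambda>k. \<eta> k \<omega>)"
  proof (rule law.AE_product)
    show "{p \<in> space ((PiM UNIV (\<lambda>_. borel) \<Otimes>\<^sub>M S) \<Otimes>\<^sub>M PiM UNIV (\<lambda>_. borel)). C (fst p) (snd p)}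
        \<in> sets ((PiM UNIV (\<lambda>_. borel) \<Otimes>\<^sub>M S) \<Otimes>\<^sub>M PiM UNIV (\<lambda>_. borel))"
      \<comment> \<open>Convergence is restated as the Cauchy property, which involves no limit and
        defines a measurable set.\<close>
      unfolding C_def Cauchy_convergent_iff[symmetric]
      by (rule sets_Collect_Cauchy, rule windowed_series_measurable) measurable
    show "AE \<omega> in M. AE \<omega>' in M. C (\<lambda>k. \<xi> k \<omega>, W \<omega>) (\<lambda>k. \<eta> k \<omega>')"
      using AE_space AE_infinite AE_summable_coefs
    proof eventually_elim
      case (elim \<omega>)
      then show ?case
        using AE_convergent_weighted_sum[OF win_exhaustion(1-3)[OF elim(1,2)] elim(3)]
        by (simp add: C_def windowed_series_eq_weighted_sum)
    qed
  qed
  then show ?thesis by (simp add: C_def)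
qed

text \<open>Averaging over the signs leaves the sum of the squared coefficients, whose expectation
  is the finite integral of \<open>f\<^sup>2\<close>. Only after this bound is Fubini available for
  the signed integral that gives the mean.\<close>

lemma shot_noise_square:
  shows "integrable M (\<lambda>\<omega>. (shot_noise_value g \<omega>)\<^sup>2)" and "expectation (shot_noise_value g) = 0"
proof -
  have meas [measurable]: "(\<lambda>p. shot_noise_sum f (fst (fst p)) (g (snd (fst p))) (snd p))
      \<in> borel_measurable ((PiM UNIV (\<lambda>_. borel) \<Otimes>\<^sub>M S) \<Otimes>\<^sub>M PiM UNIV (\<lambda>_. borel))"
    by (rule shot_noise_sum_measurable) measurable
  have meas_sq: "(\<lambda>p. ennreal ((shot_noise_sum f (fst (fst p)) (g (snd (fst p))) (snd p))\<^sup>2))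
      \<in> borel_measurable ((PiM UNIV (\<lambda>_. borel) \<Otimes>\<^sub>M S) \<Otimes>\<^sub>M PiM UNIV (\<lambda>_. borel))"
    by measurable
  have "(\<integral>\<^sup>+\<omega>. ennreal ((shot_noise_value g \<omega>)\<^sup>2) \<partial>M)
      = (\<integral>\<^sup>+\<omega>. \<integral>\<^sup>+\<omega>'. ennreal ((shot_noise_sum f (\<lambda>k. \<xi> k \<omega>) (g (W \<omega>)) (\<lambda>k. \<eta> k \<omega>'))\<^sup>2) \<partial>M \<partial>M)"
    unfolding shot_noise_value_def
    using law.nn_integral_product[OF meas_sq] by (simp only: fst_conv snd_conv)
  also have "\<dots> = (\<integral>\<^sup>+\<omega>. (\<Sum>k. ennreal ((coefs g \<omega> k)\<^sup>2)) \<partial>M)"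
  proof (rule nn_integral_cong_AE, use AE_space AE_infinite AE_summable_coefs in eventually_elim)
    case (elim \<omega>)
    note w = win_exhaustion(1-3)[OF elim(1,2)]
    have "(\<integral>\<^sup>+\<omega>'. ennreal ((noise_series (win \<omega>) (coefs g \<omega>) \<omega>')\<^sup>2) \<partial>M) = ennreal (\<Sum>k. (coefs g \<omega> k)\<^sup>2)"
      using noise_series_square_integrable[OF w elim(3)] expectation_noise_series_mult[OF w elim(3) elim(3)]
      by (simp add: nn_integral_eq_integral power2_eq_square)
    also have "\<dots> = (\<Sum>k. ennreal ((coefs g \<omega> k)\<^sup>2))"
      using elim(3) by (intro suminf_ennreal2[symmetric]) auto
    finally show ?case by (simp add: shot_noise_sum_eq_series[OF elim(1,2)])
  qed
  finally show sq: "integrable M (\<lambda>\<omega>. (shot_noise_value g \<omega>)\<^sup>2)"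
    using f_L2_finite expectation_coefs by (intro integrableI_nonneg) auto
  have "integrable M (shot_noise_value g)"
    by (rule square_integrable_imp_integrable[OF _ sq]) simp
  then have "expectation (shot_noise_value g)
      = expectation (\<lambda>\<omega>. LINT \<omega>'|M. shot_noise_sum f (\<lambda>k. \<xi> k \<omega>) (g (W \<omega>)) (\<lambda>k. \<eta> k \<omega>'))"
    unfolding shot_noise_value_def
    using law.integral_product[OF meas] by (simp only: fst_conv snd_conv)
  also have "\<dots> = 0"
  proof (rule integral_eq_zero_AE, use AE_space AE_infinite AE_summable_coefs in eventually_elim)
    case (elim \<omega>)
    then show ?case
      using expectation_noise_series[OF win_exhaustion(1-3)[OF elim(1,2)] elim(3)]
      by (simp add: shot_noise_sum_eq_series[OF elim(1,2)])
  qed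
  finally show "expectation (shot_noise_value g) = 0" .
qed

end

text \<open>Averaging over the signs leaves the sum over \<open>k\<close> of
  \<open>coefs g \<omega> k * coefs h \<omega> k\<close>; Campbell's formula turns its expectation
  into an integral over \<open>x\<close>, which reflection identifies with the covariogram at the
  difference of the field values.\<close>

lemma expectation_shot_noise_mult:
  assumes g [measurable]: "g \<in> borel_measurable S" "h \<in> borel_measurable S"
  shows "expectation (\<lambda>\<omega>. shot_noise_value g \<omega> * shot_noise_value h \<omega>)
    = expectation (\<lambda>\<omega>. covariogram f (g (W \<omega>) - h (W \<omega>)))"
proof -
  have meas: "(\<lambda>p. shot_noise_sum f (fst (fst p)) (g (snd (fst p))) (snd p)
        * shot_noise_sum f (fst (fst p)) (h (snd (fst p))) (snd p))
      \<in> borel_measurable ((PiM UNIV (\<lambda>_. borel) \<Otimes>\<^sub>M S) \<Otimes>\<^sub>M PiM UNIV (\<lambda>_. borel))"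
    by (intro borel_measurable_times shot_noise_sum_measurable) measurable
  have "integrable M (\<lambda>\<omega>. shot_noise_value g \<omega> * shot_noise_value h \<omega>)"
    by (rule integrable_mult_square) (auto intro: shot_noise_square)
  then have "expectation (\<lambda>\<omega>. shot_noise_value g \<omega> * shot_noise_value h \<omega>)
      = expectation (\<lambda>\<omega>. LINT \<omega>'|M. shot_noise_sum f (\<lambda>k. \<xi> k \<omega>) (g (W \<omega>)) (\<lambda>k. \<eta> k \<omega>')
          * shot_noise_sum f (\<lambda>k. \<xi> k \<omega>) (h (W \<omega>)) (\<lambda>k. \<eta> k \<omega>'))"
    unfolding shot_noise_value_def
    using law.integral_product[OF meas] by (simp only: fst_conv snd_conv)
  also have "\<dots> = expectation (\<lambda>\<omega>. \<Sum>k. coefs g \<omega> k * coefs h \<omega> k)"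
  proof (rule integral_cong_AE)
    show "AE \<omega> in M. (LINT \<omega>'|M. shot_noise_sum f (\<lambda>k. \<xi> k \<omega>) (g (W \<omega>)) (\<lambda>k. \<eta> k \<omega>')
          * shot_noise_sum f (\<lambda>k. \<xi> k \<omega>) (h (W \<omega>)) (\<lambda>k. \<eta> k \<omega>')) = (\<Sum>k. coefs g \<omega> k * coefs h \<omega> k)"
      using AE_space AE_infinite AE_summable_coefs[OF g(1)] AE_summable_coefs[OF g(2)]
    proof eventually_elim
      case (elim \<omega>)
      then show ?case
        using expectation_noise_series_mult[OF win_exhaustion(1-3)[OF elim(1,2)] elim(3,4)]
        by (simp add: shot_noise_sum_eq_series[OF g(1) elim(1,2)] shot_noise_sum_eq_series[OF g(2) elim(1,2)])
    qed
    show "(\<lambda>\<omega>. \<Sum>k. coefs g \<omega> k * coefs h \<omega> k) \<in> borel_measurable M"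
      unfolding coefs_def by measurable
    have "(\<lambda>(\<omega>, \<omega>'). shot_noise_sum f (\<lambda>k. \<xi> k \<omega>) (g (W \<omega>)) (\<lambda>k. \<eta> k \<omega>')
        * shot_noise_sum f (\<lambda>k. \<xi> k \<omega>) (h (W \<omega>)) (\<lambda>k. \<eta> k \<omega>')) \<in> borel_measurable (M \<Otimes>\<^sub>M M)"
      using borel_measurable_times[OF shot_noise_sum_pair_measurable[OF g(1)] shot_noise_sum_pair_measurable[OF g(2)]]
      by (simp only: case_prod_unfold)
    then show "(\<lambda>\<omega>. LINT \<omega>'|M. shot_noise_sum f (\<lambda>k. \<xi> k \<omega>) (g (W \<omega>)) (\<lambda>k. \<eta> k \<omega>')
        * shot_noise_sum f (\<lambda>k. \<xi> k \<omega>) (h (W \<omega>)) (\<lambda>k. \<eta> k \<omega>')) \<in> borel_measurable M"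
      by (rule borel_measurable_lebesgue_integral)
  qed
  also have "\<dots> = expectation (\<lambda>\<omega>. LINT x|lborel. 1 * (f (g (W \<omega>) - x) * f (h (W \<omega>) - x)))"
  proof -
    define F where "F p = f (g (fst p) - snd p) * f (h (fst p) - snd p)" for p
    define c where "c = (\<integral>\<^sup>+x. ennreal ((f x)\<^sup>2) \<partial>lborel)"
    have F [measurable]: "F \<in> borel_measurable (S \<Otimes>\<^sub>M borel)" unfolding F_def by measurable
    \<comment> \<open>The integrability condition of Campbell's formula: the product is dominated by
      the sum of the two squares, each with integral \<open>c\<close> whatever the field values
      are.\<close>
    have "(\<integral>\<^sup>+\<omega>. \<integral>\<^sup>+x. ennreal 1 * ennreal \<bar>F (W \<omega>, x)\<bar> \<partial>lborel \<partial>M) \<le> (\<integral>\<^sup>+\<omega>. c + c \<partial>M)"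
    proof (rule nn_integral_mono)
      fix \<omega>
      have "(\<integral>\<^sup>+x. ennreal 1 * ennreal \<bar>F (W \<omega>, x)\<bar> \<partial>lborel)
          \<le> (\<integral>\<^sup>+x. ennreal ((f (g (W \<omega>) - x))\<^sup>2) + ennreal ((f (h (W \<omega>) - x))\<^sup>2) \<partial>lborel)"
        using abs_mult_le_sum_squares
        by (intro nn_integral_mono) (simp add: F_def flip: ennreal_plus)
      also have "\<dots> = c + c"
        unfolding c_def using nn_integral_reflect_translate[of "\<lambda>x. ennreal ((f x)\<^sup>2)" "g (W \<omega>)"]
          nn_integral_reflect_translate[of "\<lambda>x. ennreal ((f x)\<^sup>2)" "h (W \<omega>)"]
        by (subst nn_integral_add) simp_all
      finally show "(\<integral>\<^sup>+x. ennreal 1 * ennreal \<bar>F (W \<omega>, x)\<bar> \<partial>lborel) \<le> c + c" .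
    qed
    also have "\<dots> < \<infinity>"
      using f_L2_finite by (simp add: emeasure_space_1 c_def)
    finally have "expectation (\<lambda>\<omega>. \<Sum>k. F (W \<omega>, \<xi> k \<omega>)) = expectation (\<lambda>\<omega>. LINT x|lborel. 1 * F (W \<omega>, x))"
      by (rule Campbell[OF F])
    then show ?thesis
      unfolding F_def coefs_def by simp
  qed
  also have "\<dots> = expectation (\<lambda>\<omega>. covariogram f (g (W \<omega>) - h (W \<omega>)))"
    by (simp only: mult_1 covariogram_reflect)
  finally show ?thesis .
qed

end

section \<open>From the independence hypotheses to the covariance of the field\<close>

lemma (in prob_space) indep_set_commute:
  assumes "indep_set A B" shows "indep_set B A"
proof (rule indep_setI)
  show "prob (a \<inter> b) = prob a * prob b" if "a \<in> B" "b \<in> A" for a b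
    using indep_setD[OF assms that(2,1)] by (simp add: Int_commute mult.commute)
qed (rule indep_setD_ev2[OF assms], rule indep_setD_ev1[OF assms])

lemma measurable_UNIV_PiM:
  assumes "\<And>k. X k \<in> borel_measurable N"
  shows "(\<lambda>\<omega> k. X k \<omega>) \<in> measurable N (PiM UNIV (\<lambda>_. borel))"
  by (rule measurable_PiM_single') (use assms in auto)

lemma measurable_into_sigma_sets:
  assumes "X \<in> measurable (sigma (space M) G) S" "G \<subseteq> Pow (space M)" "C \<in> sets S"
  shows "X -` C \<inter> space M \<in> sigma_sets (space M) G"
  using measurable_sets[OF assms(1,3)] assms(2) by (simp add: space_measure_of_conv sets_measure_of)

text \<open>Two different independences are used: counts of \<open>X\<close> against events of
  \<open>Z\<close> feed Campbell's formula, and the marks against the enumeration together with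
  \<open>Z\<close> give the product law. The values at the two points \<open>u\<close> and
  \<open>v\<close> are kept as one pair because a covariance needs their joint law.\<close>

lemma shot_noise_intro:
  fixes Z :: "'a \<Rightarrow> 'w \<Rightarrow> real"
  assumes "prob_space M"
    and f: "f \<in> borel_measurable borel" "integrable lborel (\<lambda>x. (f x)\<^sup>2)"
    and pois: "poisson_process M 1 X"
    and indep_XZ: "prob_space.indep_set M (point_events M X) (generated_events M P Z)"
    and enum: "enumerates M X \<xi>"
    and signs: "random_signs M UNIV \<eta>"
    and indep_\<eta>: "prob_space.indep_set M (generated_events M UNIV \<eta>)
      (sigma_sets (space M) (generated_events M UNIV \<xi> \<union> generated_events M P Z))"
    and u: "u \<in> P" and v: "v \<in> P"
  shows "shot_noise M X \<xi> (borel \<Otimes>\<^sub>M borel) (\<lambda>\<omega>. (Z u \<omega>, Z v \<omega>)) \<eta> f"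
proof -
  interpret prob_space M by fact
  interpret noise: orthonormal_noise M \<eta>
    by (rule orthonormal_noise_random_signs) fact+
  interpret pp: poisson_points M 1 X
    by unfold_locales (use pois in auto)
  define G where "G = generated_events M UNIV \<xi> \<union> generated_events M P Z"
  have G: "G \<subseteq> Pow (space M)"
    unfolding G_def by (intro Un_least generated_events_subset_Pow)
  have sub: "sigma_sets (space M) G \<subseteq> sets M"
    using indep_setD_ev2[OF indep_\<eta>] unfolding G_def .
  \<comment> \<open>Events generated by \<xi> and \<open>Z\<close> are events of \<open>M\<close>,
    since independence includes this; so measurability proved in the smaller sigma-algebra, needed
    for independence, also yields measurability in \<open>M\<close>.\<close>
  have lift: "h \<in> measurable M S" if "h \<in> measurable (sigma (space M) G') S" "G' \<subseteq> G" for h S G'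
  proof (rule measurableI)
    have G': "G' \<subseteq> Pow (space M)" using G that(2) by blast
    show "h -` C \<inter> space M \<in> sets M" if "C \<in> sets S" for C
      using measurable_into_sigma_sets[OF \<open>h \<in> measurable (sigma (space M) G') S\<close> G' that]
        sigma_sets_mono'[OF \<open>G' \<subseteq> G\<close>, of "space M"] sub by blast
    show "h \<omega> \<in> space S" if "\<omega> \<in> space M" for \<omega>
      using measurable_space[OF \<open>h \<in> measurable (sigma (space M) G') S\<close>] that
      by (simp add: space_measure_of_conv)
  qed
  have Z_gen: "Z w \<in> borel_measurable (sigma (space M) (generated_events M P Z))" if "w \<in> P" for w
    by (rule measurable_sigma_generated[OF subset_refl generated_events_subset_Pow that])
  have WZ: "(\<lambda>\<omega>. (Z u \<omega>, Z v \<omega>)) \<in> measurable (sigma (space M) (generated_events M P Z)) (borel \<Otimes>\<^sub>M borel)"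
    using Z_gen u v by (intro measurable_Pair) auto
  have W: "(\<lambda>\<omega>. (Z u \<omega>, Z v \<omega>)) \<in> measurable M (borel \<Otimes>\<^sub>M borel)"
    by (rule lift[OF WZ]) (simp add: G_def)
  have "(\<lambda>\<omega>. (Z u \<omega>, Z v \<omega>)) -` C \<inter> space M \<in> generated_events M P Z"
    if "C \<in> sets (borel \<Otimes>\<^sub>M borel)" for C
    using measurable_sets[OF WZ that] by (simp add: space_measure_of_conv sets_sigma_generated_events)
  note W_events = this
  have counts: "prob ({\<omega> \<in> space M. card (X \<omega> \<inter> A) = n} \<inter> ((\<lambda>\<omega>. (Z u \<omega>, Z v \<omega>)) -` C \<inter> space M))
      = prob {\<omega> \<in> space M. card (X \<omega> \<inter> A) = n} * prob ((\<lambda>\<omega>. (Z u \<omega>, Z v \<omega>)) -` C \<inter> space M)"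
    if "A \<in> sets borel" "bounded A" "C \<in> sets (borel \<Otimes>\<^sub>M borel)" for A C n
  proof (rule indep_setD[OF indep_XZ _ W_events[OF that(3)]])
    show "{\<omega> \<in> space M. card (X \<omega> \<inter> A) = n} \<in> point_events M X"
      unfolding point_events_def using that(1,2) by (intro sigma_sets.Basic) blast
  qed
  have \<xi>G: "\<xi> k \<in> borel_measurable (sigma (space M) G)" for k
    by (rule measurable_sigma_generated[OF _ G]) (auto simp: G_def)
  have ZG: "Z w \<in> borel_measurable (sigma (space M) G)" if "w \<in> P" for w
    by (rule measurable_sigma_generated[OF _ G that]) (auto simp: G_def)
  have \<Theta>G: "(\<lambda>\<omega>. (\<lambda>k. \<xi> k \<omega>, (Z u \<omega>, Z v \<omega>)))
      \<in> measurable (sigma (space M) G) (PiM UNIV (\<lambda>_. borel) \<Otimes>\<^sub>M (borel \<Otimes>\<^sub>M borel))"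
    by (intro measurable_Pair measurable_UNIV_PiM \<xi>G ZG u v)
  have \<eta>_gen: "(\<lambda>\<omega> k. \<eta> k \<omega>) \<in> measurable (sigma (space M) (generated_events M UNIV \<eta>)) (PiM UNIV (\<lambda>_. borel))"
    by (intro measurable_UNIV_PiM measurable_sigma_generated[OF subset_refl generated_events_subset_Pow]) simp
  have law: "product_law M (PiM UNIV (\<lambda>_. borel) \<Otimes>\<^sub>M (borel \<Otimes>\<^sub>M borel)) (PiM UNIV (\<lambda>_. borel))
      (\<lambda>\<omega>. (\<lambda>k. \<xi> k \<omega>, (Z u \<omega>, Z v \<omega>))) (\<lambda>\<omega> k. \<eta> k \<omega>)"
  proof
    show \<Theta>: "(\<lambda>\<omega>. (\<lambda>k. \<xi> k \<omega>, (Z u \<omega>, Z v \<omega>)))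
        \<in> measurable M (PiM UNIV (\<lambda>_. borel) \<Otimes>\<^sub>M (borel \<Otimes>\<^sub>M borel))"
      by (rule lift[OF \<Theta>G subset_refl])
    show H: "(\<lambda>\<omega> k. \<eta> k \<omega>) \<in> measurable M (PiM UNIV (\<lambda>_. borel))"
      by (intro measurable_UNIV_PiM noise.noise_measurable)
    show "distr M (PiM UNIV (\<lambda>_. borel) \<Otimes>\<^sub>M (borel \<Otimes>\<^sub>M borel)) (\<lambda>\<omega>. (\<lambda>k. \<xi> k \<omega>, (Z u \<omega>, Z v \<omega>)))
        \<Otimes>\<^sub>M distr M (PiM UNIV (\<lambda>_. borel)) (\<lambda>\<omega> k. \<eta> k \<omega>)
      = distr M ((PiM UNIV (\<lambda>_. borel) \<Otimes>\<^sub>M (borel \<Otimes>\<^sub>M borel)) \<Otimes>\<^sub>M PiM UNIV (\<lambda>_. borel))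
          (\<lambda>\<omega>. ((\<lambda>k. \<xi> k \<omega>, (Z u \<omega>, Z v \<omega>)), (\<lambda>k. \<eta> k \<omega>)))"
    proof (rule distr_pair_indep_set[OF indep_set_commute[OF indep_\<eta>] \<Theta> _ H])
      show "(\<lambda>\<omega>. (\<lambda>k. \<xi> k \<omega>, (Z u \<omega>, Z v \<omega>))) -` C \<inter> space M
          \<in> sigma_sets (space M) (generated_events M UNIV \<xi> \<union> generated_events M P Z)"
        if "C \<in> sets (PiM UNIV (\<lambda>_. borel) \<Otimes>\<^sub>M (borel \<Otimes>\<^sub>M borel))" for C
        using measurable_into_sigma_sets[OF \<Theta>G G that] unfolding G_def .
      show "(\<lambda>\<omega> k. \<eta> k \<omega>) -` C \<inter> space M \<in> generated_events M UNIV \<eta>"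
        if "C \<in> sets (PiM UNIV (\<lambda>_. borel))" for C
        using measurable_sets[OF \<eta>_gen that] by (simp add: space_measure_of_conv sets_sigma_generated_events)
    qed
  qed
  show ?thesis
    by (intro shot_noise.intro marked_poisson_points.intro pp.poisson_points_axioms
        noise.orthonormal_noise_axioms marked_poisson_points_axioms.intro shot_noise_axioms.intro
        enum W counts law f)
qed

theorem proposition3p3:
  fixes M :: "'w measure" and G :: "'a egraph" and u0 :: 'a
    and Z :: "'a \<Rightarrow> 'w \<Rightarrow> real" and dR :: "'a \<Rightarrow> 'a \<Rightarrow> real"
    and f :: "real \<Rightarrow> real" and X :: "'w \<Rightarrow> real set" and eps :: "real \<Rightarrow> 'w \<Rightarrow> real"
    and Y :: "'a \<Rightarrow> 'w \<Rightarrow> real"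
  assumes "prob_space M"
    and "euclidean_graph G" and "u0 \<in> vertices G"
    and "auxiliary_field M G u0 Z"
    and "dR = resistance_metric M Z"
    and "f \<in> borel_measurable borel" and "integrable lborel (\<lambda>x. (f x)\<^sup>2)"
    and "poisson_process M 1 X"
    and "prob_space.indep_set M (point_events M X) (generated_events M (points G) Z)"
    and "independent_signs M X (generated_events M (points G) Z) eps"
    and "Y = poisson_field X eps f Z"
  shows "(\<forall>u\<in>points G.
            (AE \<omega> in M. convergent (\<lambda>n. window_sum X eps f Z n u \<omega>))
            \<and> Y u \<in> borel_measurable M \<and> integrable M (\<lambda>\<omega>. (Y u \<omega>)\<^sup>2)
            \<and> prob_space.expectation M (Y u) = 0)
         \<and> (\<exists>C :: real \<Rightarrow> real.
            (\<forall>u\<in>points G. \<forall>v\<in>points G. covariance M (Y u) (Y v) = C (dR u v))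
            \<and> (\<forall>u\<in>points G. \<forall>v\<in>points G.
                 C (dR u v) = 1 / sqrt (2 * pi)
                   * (LINT z|lborel. covariogram f (sqrt (dR u v) * z) * exp (- z\<^sup>2 / 2))))"
proof -
  interpret prob_space M by fact
  note f [measurable] = \<open>f \<in> borel_measurable borel\<close>
  obtain \<xi> where enum: "enumerates M X \<xi>"
    and signs: "random_signs M UNIV (\<lambda>k \<omega>. eps (\<xi> k \<omega>) \<omega>)"
    and indep: "indep_set (generated_events M UNIV (\<lambda>k \<omega>. eps (\<xi> k \<omega>) \<omega>))
               (sigma_sets (space M) (generated_events M UNIV \<xi> \<union> generated_events M (points G) Z))"
    using assms(10) unfolding independent_signs_def by blast
  define \<eta> where "\<eta> k \<omega> = eps (\<xi> k \<omega>) \<omega>" for k \<omega>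
  \<comment> \<open>Each pair of points has its own instance of the model, but all instances share
    one enumeration and one sign sequence.\<close>
  have sn: "shot_noise M X \<xi> (borel \<Otimes>\<^sub>M borel) (\<lambda>\<omega>. (Z u \<omega>, Z v \<omega>)) \<eta> f"
    if "u \<in> points G" "v \<in> points G" for u v
    unfolding \<eta>_def[abs_def] by (rule shot_noise_intro) (fact assms enum signs indep that)+
  have Z_rv [measurable]: "Z u \<in> borel_measurable M" if "u \<in> points G" for u
    by (rule auxiliary_field_gaussian(1)) (fact assms that)+
  have field: "(AE \<omega> in M. convergent (\<lambda>n. window_sum X eps f Z n u \<omega>))
      \<and> Y u \<in> borel_measurable M \<and> integrable M (\<lambda>\<omega>. (Y u \<omega>)\<^sup>2) \<and> expectation (Y u) = 0"
    and cov: "expectation (\<lambda>\<omega>. Y u \<omega> * Y v \<omega>) = expectation (\<lambda>\<omega>. covariogram f (Z u \<omega> - Z v \<omega>))"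
    if u: "u \<in> points G" and v: "v \<in> points G" for u v
  proof -
    interpret shot_noise M X \<xi> "borel \<Otimes>\<^sub>M borel" "\<lambda>\<omega>. (Z u \<omega>, Z v \<omega>)" \<eta> f
      by (rule sn[OF u v])
    \<comment> \<open>The identity holds for all windows at once off the null set of finite
      configurations, so it passes to convergence and to limits.\<close>
    have window: "AE \<omega> in M. \<forall>n. window_sum X eps f Z n w \<omega>
        = windowed_series f n (\<lambda>k. \<xi> k \<omega>) (Z w \<omega>) (\<lambda>k. \<eta> k \<omega>)" for w
      using AE_space AE_infinite by eventually_elim (simp add: window_sum_eq[OF _ _ \<eta>_def])
    have Y_value: "AE \<omega> in M. Y w \<omega> = shot_noise_value g \<omega>"
      if "\<And>\<omega>. g (Z u \<omega>, Z v \<omega>) = Z w \<omega>" for w g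
      using window[of w]
      by eventually_elim
        (simp add: assms(11) poisson_field_def shot_noise_value_def shot_noise_sum_def that)
    \<comment> \<open>Measurability is derived from the window sums themselves: almost sure equality
      with a measurable function would not suffice when \<open>M\<close> is not complete.\<close>
    have Y_meas: "Y w \<in> borel_measurable M" if w: "w \<in> points G" for w
    proof -
      have [measurable]: "window_sum X eps f Z n w \<in> borel_measurable M" for n
        by (rule window_sum_measurable[of \<xi> eps Z w f, OF enum _ Z_rv[OF w] f]) (rule noise_measurable[unfolded \<eta>_def])
      show ?thesis unfolding assms(11) poisson_field_def[abs_def] by measurable
    qed
    note Yu = Y_value[of fst u, OF fst_conv] and Yv = Y_value[of snd v, OF snd_conv]
    have value_meas: "shot_noise_value fst \<in> borel_measurable M" "shot_noise_value snd \<in> borel_measurable M"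
      by (rule shot_noise_value_measurable; simp)+
    have "AE \<omega> in M. convergent (\<lambda>n. window_sum X eps f Z n u \<omega>)"
      using AE_convergent_windowed_series[OF measurable_fst] window[of u]
      by eventually_elim simp
    moreover have "integrable M (\<lambda>\<omega>. (Y u \<omega>)\<^sup>2) \<longleftrightarrow> integrable M (\<lambda>\<omega>. (shot_noise_value fst \<omega>)\<^sup>2)"
      using Yu by (intro integrable_cong_AE) (auto intro!: borel_measurable_power Y_meas u value_meas)
    moreover have "expectation (Y u) = expectation (shot_noise_value fst)"
      using Yu by (intro integral_cong_AE) (auto intro!: Y_meas u value_meas)
    ultimately show "(AE \<omega> in M. convergent (\<lambda>n. window_sum X eps f Z n u \<omega>))
      \<and> Y u \<in> borel_measurable M \<and> integrable M (\<lambda>\<omega>. (Y u \<omega>)\<^sup>2) \<and> expectation (Y u) = 0"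
      using shot_noise_square[OF measurable_fst] Y_meas[OF u] by simp
    have "expectation (\<lambda>\<omega>. Y u \<omega> * Y v \<omega>) = expectation (\<lambda>\<omega>. shot_noise_value fst \<omega> * shot_noise_value snd \<omega>)"
    proof (rule integral_cong_AE)
      show "AE \<omega> in M. Y u \<omega> * Y v \<omega> = shot_noise_value fst \<omega> * shot_noise_value snd \<omega>"
        using Yu Yv by eventually_elim simp
    qed (intro borel_measurable_times Y_meas u v value_meas)+
    then show "expectation (\<lambda>\<omega>. Y u \<omega> * Y v \<omega>) = expectation (\<lambda>\<omega>. covariogram f (Z u \<omega> - Z v \<omega>))"
      using expectation_shot_noise_mult[OF measurable_fst measurable_snd] by simp
  qed
  have covariogram_meas: "covariogram f \<in> borel_measurable borel"
    unfolding covariogram_def[abs_def] by measurable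
  have C: "covariance M (Y u) (Y v) = 1 / sqrt (2 * pi)
      * (LINT z|lborel. covariogram f (sqrt (dR u v) * z) * exp (- z\<^sup>2 / 2))"
    if u: "u \<in> points G" and v: "v \<in> points G" for u v
  proof -
    obtain s where s: "distr M borel (\<lambda>\<omega>. Z u \<omega> - Z v \<omega>) = normal_law 0 s"
      using auxiliary_field_gaussian(2)[OF assms(2,4) u v] by blast
    have meas: "(\<lambda>\<omega>. Z u \<omega> - Z v \<omega>) \<in> borel_measurable M"
      using u v by measurable
    \<comment> \<open>This identifies the unknown parameter of the normal law with the resistance
      metric.\<close>
    have dR: "dR u v = \<bar>s\<bar>"
      unfolding assms(5) resistance_metric_def by (rule variance_normal_law[OF meas s])
    \<comment> \<open>Both means vanish, so the covariance is the expectation of the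
      product.\<close>
    have "covariance M (Y u) (Y v) = expectation (\<lambda>\<omega>. covariogram f (Z u \<omega> - Z v \<omega>))"
      using field[OF u v] field[OF v u] cov[OF u v] by (simp add: covariance_def)
    also have "\<dots> = (LINT z|lborel. std_normal_density z * covariogram f (sqrt (dR u v) * z))"
      unfolding dR by (rule expectation_normal_law[OF meas s covariogram_meas])
    also have "\<dots> = (LINT z|lborel. 1 / sqrt (2 * pi) * (covariogram f (sqrt (dR u v) * z) * exp (- z\<^sup>2 / 2)))"
      by (simp add: std_normal_density_def mult_ac)
    also have "\<dots> = 1 / sqrt (2 * pi) * (LINT z|lborel. covariogram f (sqrt (dR u v) * z) * exp (- z\<^sup>2 / 2))"
      by (rule integral_mult_right_zero)
    finally show ?thesis .
  qed
  show ?thesis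
  proof (intro conjI ballI exI)
    \<comment> \<open>The formula contains \<open>u\<close> and \<open>v\<close> only through
      \<open>dR u v\<close>, so read as a function of a real variable it is itself the witness for
      the existential.\<close>
    show "covariance M (Y u) (Y v) = (\<lambda>r. 1 / sqrt (2 * pi)
        * (LINT z|lborel. covariogram f (sqrt r * z) * exp (- z\<^sup>2 / 2))) (dR u v)"
      if "u \<in> points G" "v \<in> points G" for u v
      using C[OF that] .
  qed (use field in auto)
qed

end
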